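(* Let $p\in\{0,1,\ldots,6\}$, let $\Omega\subseteq\mathbb{O}$ be a slice domain and let $f:\Omega\to\mathbb{O}$ be a (left) generalized partial-slice monogenic function of type $p$. If $|f|$ has a relative maximum at some point in $\Omega$, then $f$ is constant.
   Context: $\mathbb{O}$ is the real, non-associative, alternative algebra of octonions with basis $e_0=1,e_1,\ldots,e_7$ and product $e_ie_j=-\delta_{ij}+\sum_k\epsilon_{ijk}e_k$ for $1\le i,j\le 7$, where $\epsilon_{ijk}$ is totally antisymmetric, equals $1$ on the triples $(1,2,3),(1,4,5),(2,4,6),(3,4,7),(5,3,6),(6,1,7),(7,2,5)$, and vanishes on triples that are not permutations of these. $\mathbb{O}$ is identified with $\mathbb{R}^8$ with Euclidean norm $|\cdot|$. A domain is a connected open set. Fix $p\in\{0,\ldots,6\}$ and $q=7-p$. $\mathbb{R}^{p+1}$ denotes the real span of $e_0,\ldots,e_p$, with elements $\boldsymbol{x}_p=\sum_{i=0}^px_ie_i$, and $\mathbb{S}=\{\sum_{i=p+1}^7x_ie_i:\sum_{i=p+1}^7x_i^2=1\}$. For $\Omega\subseteq\mathbb{O}$ open and $\underline{\omega}\in\mathbb{S}$ put $\Omega_{\underline{\omega}}=\Omega\cap(\mathbb{R}^{p+1}\oplus\underline{\omega}\mathbb{R})$, viewed as an open subset of $\mathbb{R}^{p+2}$ with coordinates $(x_0,\ldots,x_p,r)\leftrightarrow\boldsymbol{x}_p+r\underline{\omega}$. A function $f:\Omega\to\mathbb{O}$ on a domain $\Omega\subseteq\mathbb{O}$ is (left) generalized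 partial-slice monogenic of type $p$ if, for every $\underline{\omega}\in\mathbb{S}$, its restriction $f_{\underline{\omega}}$ to $\Omega_{\underline{\omega}}$ is of class $C^1$ and satisfies $D_{\underline{\omega}}f_{\underline{\omega}}:=\sum_{i=0}^pe_i\,\partial_{x_i}f_{\underline{\omega}}+\underline{\omega}\,\partial_rf_{\underline{\omega}}=0$ on $\Omega_{\underline{\omega}}$. A domain $\Omega$ is a slice domain if $\Omega\cap\mathbb{R}^{p+1}\ne\emptyset$ and $\Omega_{\underline{\omega}}$ is a domain in $\mathbb{R}^{p+2}$ for every $\underline{\omega}\in\mathbb{S}$. *)

theory Defs
  imports "HOL-Analysis.Analysis"
begin

type_synonym octonion = "real ^ 8"

text \<open>The elements of the index type \<^typ>\<open>8\<close> are the residues \<open>0, \<dots>, 7\<close>, so \<open>oct_e i\<close> is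
  the basis vector \<open>e\<^sub>i\<close> for \<open>i \<le> 7\<close>; it is never used for larger \<open>i\<close>.\<close>

definition oct_e :: "nat \<Rightarrow> octonion" where
  "oct_e i = axis (of_nat i) 1"

definition oct_triples :: "(nat \<times> nat \<times> nat) set" where
  "oct_triples = {(1,2,3), (1,4,5), (2,4,6), (3,4,7), (5,3,6), (6,1,7), (7,2,5)}"

definition oct_eps :: "nat \<Rightarrow> nat \<Rightarrow> nat \<Rightarrow> real" where
  "oct_eps i j k =
     (if (i,j,k) \<in> oct_triples \<or> (j,k,i) \<in> oct_triples \<or> (k,i,j) \<in> oct_triples then 1
      else if (j,i,k) \<in> oct_triples \<or> (i,k,j) \<in> oct_triples \<or> (k,j,i) \<in> oct_triples then -1
      else 0)"

definition oct_table :: "nat \<Rightarrow> nat \<Rightarrow> octonion" where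
  "oct_table i j =
     (if i = 0 then oct_e j
      else if j = 0 then oct_e i
      else (if i = j then - oct_e 0 else 0) + (\<Sum>k=1..7. oct_eps i j k *\<^sub>R oct_e k))"

definition oct_mult :: "octonion \<Rightarrow> octonion \<Rightarrow> octonion" (infixl "\<otimes>" 70) where
  "x \<otimes> y = (\<Sum>i\<le>7. \<Sum>j\<le>7. ((x \<bullet> oct_e i) * (y \<bullet> oct_e j)) *\<^sub>R oct_table i j)"

lemma oct_e_inner:
  assumes "i \<le> 7" "j \<le> 7"
  shows "oct_e i \<bullet> oct_e j = (if i = j then 1 else 0)"
proof -
  have "i \<in> {0,1,2,3,4,5,6,7}" "j \<in> {0,1,2,3,4,5,6,7}" using assms by auto
  hence "(of_nat i :: 8) = of_nat j \<longleftrightarrow> i = j" by auto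
  thus ?thesis by (auto simp: oct_e_def inner_axis_axis)
qed

lemma oct_mult_basis:
  assumes "i \<le> 7" "j \<le> 7"
  shows "oct_e i \<otimes> oct_e j = oct_table i j"
proof -
  have "oct_e i \<otimes> oct_e j =
      (\<Sum>k\<le>7. \<Sum>l\<le>7. if k = i then if l = j then oct_table k l else 0 else 0)"
    unfolding oct_mult_def using assms
    by (intro sum.cong refl) (auto simp: oct_e_inner)
  also have "\<dots> = (\<Sum>k\<le>7. if k = i then oct_table k j else 0)"
    using assms by (intro sum.cong refl) (simp add: sum.delta)
  also have "\<dots> = oct_table i j" using assms by simp
  finally show ?thesis .
qed

definition oct_domain :: "octonion set \<Rightarrow> bool" where
  "oct_domain \<Omega> \<longleftrightarrow> open \<Omega> \<and> connected \<Omega>"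

definition paravectors :: "nat \<Rightarrow> octonion set" where
  "paravectors p = span (oct_e ` {..p})"

definition slice_sphere :: "nat \<Rightarrow> octonion set" where
  "slice_sphere p = {(\<Sum>i=p+1..7. x i *\<^sub>R oct_e i) | x :: nat \<Rightarrow> real. (\<Sum>i=p+1..7. (x i)\<^sup>2) = 1}"

definition slice_space :: "nat \<Rightarrow> octonion \<Rightarrow> octonion set" where
  "slice_space p \<omega> = {x + r *\<^sub>R \<omega> | x r. x \<in> paravectors p}"

definition oct_slice :: "nat \<Rightarrow> octonion set \<Rightarrow> octonion \<Rightarrow> octonion set" where
  "oct_slice p \<Omega> \<omega> = \<Omega> \<inter> slice_space p \<omega>"

text \<open>In the coordinates \<open>(x\<^sub>0, \<dots>, x\<^sub>p, r)\<close> on \<open>slice_space p \<omega>\<close>, the partial derivatives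
  \<open>\<partial>/\<partial>x\<^sub>i\<close> and \<open>\<partial>/\<partial>r\<close> are the directional derivatives along \<open>e\<^sub>i\<close> and \<open>\<omega>\<close>. As \<open>\<Omega>\<close> is open,
  at a point of a slice they only involve values of \<open>f\<close> on that slice.\<close>

definition dir_deriv :: "octonion \<Rightarrow> (octonion \<Rightarrow> octonion) \<Rightarrow> octonion \<Rightarrow> octonion" where
  "dir_deriv v f x = vector_derivative (\<lambda>t. f (x + t *\<^sub>R v)) (at 0)"

text \<open>Class \<open>C\<^sup>1\<close>: all first-order partial derivatives exist and are continuous on the slice.\<close>

definition C1_on_slice :: "nat \<Rightarrow> octonion \<Rightarrow> octonion set \<Rightarrow> (octonion \<Rightarrow> octonion) \<Rightarrow> bool" where
  "C1_on_slice p \<omega> \<Omega> f \<longleftrightarrow>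
     (\<forall>v \<in> insert \<omega> (oct_e ` {..p}).
        (\<forall>x \<in> oct_slice p \<Omega> \<omega>. (\<lambda>t. f (x + t *\<^sub>R v)) differentiable (at (0::real))) \<and>
        continuous_on (oct_slice p \<Omega> \<omega>) (dir_deriv v f))"

definition slice_dirac :: "nat \<Rightarrow> octonion \<Rightarrow> (octonion \<Rightarrow> octonion) \<Rightarrow> octonion \<Rightarrow> octonion" where
  "slice_dirac p \<omega> f x = (\<Sum>i\<le>p. oct_e i \<otimes> dir_deriv (oct_e i) f x) + \<omega> \<otimes> dir_deriv \<omega> f x"

definition partial_slice_monogenic ::
  "nat \<Rightarrow> octonion set \<Rightarrow> (octonion \<Rightarrow> octonion) \<Rightarrow> bool" where
  "partial_slice_monogenic p \<Omega> f \<longleftrightarrow>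
     oct_domain \<Omega> \<and>
     (\<forall>\<omega> \<in> slice_sphere p.
        C1_on_slice p \<omega> \<Omega> f \<and> (\<forall>x \<in> oct_slice p \<Omega> \<omega>. slice_dirac p \<omega> f x = 0))"

definition slice_domain :: "nat \<Rightarrow> octonion set \<Rightarrow> bool" where
  "slice_domain p \<Omega> \<longleftrightarrow>
     oct_domain \<Omega> \<and>
     \<Omega> \<inter> paravectors p \<noteq> {} \<and>
     (\<forall>\<omega> \<in> slice_sphere p.
        openin (top_of_set (slice_space p \<omega>)) (oct_slice p \<Omega> \<omega>) \<and>
        connected (oct_slice p \<Omega> \<omega>))"

definition relative_max_at :: "octonion set \<Rightarrow> (octonion \<Rightarrow> real) \<Rightarrow> octonion \<Rightarrow> bool" where
  "relative_max_at \<Omega> g a \<longleftrightarrow> (\<exists>\<delta>>0. \<forall>x \<in> \<Omega>. dist x a < \<delta> \<longrightarrow> g x \<le> g a)"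

end

theory Submission
  imports Defs
begin

text \<open>
Fix \<open>\<omega>\<close> in the sphere. Composing \<open>f\<close> with the orthogonal projection of \<open>\<real>\<^sup>8\<close> onto the slice space of
\<open>\<omega>\<close> gives a \<open>C\<^sup>1\<close> function \<open>F\<close> on an open set of \<open>\<real>\<^sup>8\<close> that solves \<open>\<Sum>\<^sub>i e\<^sub>i (\<partial>\<^sub>i F) = 0\<close>: the directions
orthogonal to the slice contribute nothing, and the components of \<open>\<omega>\<close> reassemble \<open>\<omega> \<partial>\<^sub>r f\<close>. So every
slice is governed by one first-order system on \<open>\<real>\<^sup>8\<close>, whatever \<open>p\<close> is.

Since the algebra is alternative, \<open>c\<^sub>i e\<^sub>i (e\<^sub>j z) + c\<^sub>j e\<^sub>j (e\<^sub>i z) = 2 \<delta>\<^sub>i\<^sub>j z\<close>, where \<open>c\<^sub>0 = 1\<close> and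
\<open>c\<^sub>i = -1\<close> otherwise (\<open>oct_clifford\<close>). Hence the system factorizes the Laplacian, and \<open>F\<close> is harmonic
in the weak sense. As \<open>F\<close> is only \<open>C\<^sup>1\<close>, harmonicity is used solely through a mean value property with
the weight \<open>u\<^sub>t\<^sup>2\<close>, \<open>u\<^sub>t(y) = max 0 (t\<^sup>2 - |y|\<^sup>2)\<close>, obtained by testing against \<open>y\<^sub>i u\<^sub>t\<^sup>2\<close>
(\<open>octonion_monogenic_bump_mean_value\<close>). Two consequences of this property carry the proof:

\<^item> if \<open>|F|\<close> attains its maximum over a ball at the centre, then \<open>F\<close> is constant on the ball, because
  the mean of the nonnegative function \<open>|F(x)|\<^sup>2 - \<langle>F(x), F(x + y)\<rangle>\<close> vanishes
  (\<open>bump_mean_value_norm_max_imp_const\<close>);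

\<^item> if \<open>F\<close> vanishes on a nonempty open subset of a connected open set, then it vanishes throughout
  (\<open>bump_mean_value_unique_continuation\<close>). The weight is Lipschitz, so \<open>k\<close>-th finite differences of \<open>F\<close>
  are bounded by \<open>(C k |h| / r)\<^sup>k sup |F|\<close>; Newton's forward difference formula then plays the role that
  the Taylor series plays for analytic functions, without any derivative being taken.

Now let \<open>|f|\<close> have a relative maximum at \<open>a\<close>. On a slice through \<open>a\<close> the two facts give \<open>f = f(a)\<close>. In
particular \<open>f = f(a)\<close> on the paravectors in the domain, which lie in every slice. On any other slice,
\<open>f - f(a)\<close> vanishes on the hyperplane \<open>r = 0\<close>, hence so do its tangential derivatives, and by the
equation also \<open>\<partial>\<^sub>r f\<close>. Therefore \<open>f - f(a)\<close>, replaced by \<open>0\<close> where \<open>r \<le> 0\<close>, is still a \<open>C\<^sup>1\<close> solution; it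
vanishes on the open set \<open>r < 0\<close>, so it vanishes everywhere (\<open>constant_on_half_slice\<close>). Every point of the
domain lies in the half \<open>r > 0\<close> of some slice or is a paravector.
\<close>

section \<open>Integrals of compactly supported functions\<close>

lemma integrable_compact_support:
  fixes G :: "'a::euclidean_space \<Rightarrow> 'b::euclidean_space"
  assumes "continuous_on UNIV G" and "\<And>y. y \<notin> cbox a b \<Longrightarrow> G y = 0"
  shows "G integrable_on UNIV" and "integral UNIV G = integral (cbox a b) G"
proof -
  have "(G has_integral integral (cbox a b) G) (cbox a b)"
    using assms(1) by (meson continuous_on_subset integrable_continuous integrable_integral top_greatest)
  then have *: "(G has_integral integral (cbox a b) G) UNIV"
    using has_integral_on_superset[of G _ "cbox a b" UNIV] assms(2) by auto
  show "G integrable_on UNIV" "integral UNIV G = integral (cbox a b) G"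
    using * by (auto simp: integral_unique has_integral_integrable)
qed

lemma cball_subset_cube:
  fixes y :: "'a::euclidean_space"
  assumes "norm y \<le> R"
  shows "y \<in> cbox (- R *\<^sub>R One) (R *\<^sub>R One)"
  using assms Basis_le_norm[of _ y] by (fastforce simp: mem_box abs_le_iff)

lemma integrable_ball_support:
  fixes G :: "'a::euclidean_space \<Rightarrow> 'b::euclidean_space"
  assumes "continuous_on UNIV G" and "\<And>y. norm y > R \<Longrightarrow> G y = 0"
  shows "G integrable_on UNIV" and "integral UNIV G = integral (cbox (- R *\<^sub>R One) (R *\<^sub>R One)) G"
proof -
  have "G y = 0" if "y \<notin> cbox (- R *\<^sub>R One) (R *\<^sub>R One)" for y
    using that cball_subset_cube[of y R] assms(2) by (meson not_le)
  then show "G integrable_on UNIV" "integral UNIV G = integral (cbox (- R *\<^sub>R One) (R *\<^sub>R One)) G"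
    using integrable_compact_support[OF assms(1)] by blast+
qed

lemma integral_UNIV_translation:
  fixes G :: "'a::euclidean_space \<Rightarrow> 'b::euclidean_space"
  assumes "continuous_on UNIV G" and "\<And>y. norm y > R \<Longrightarrow> G y = 0"
  shows "integral UNIV (\<lambda>y. G (y + c)) = integral UNIV G"
proof -
  define a b :: 'a where "a = - R *\<^sub>R One" and "b = R *\<^sub>R One"
  have out: "G y = 0" if "y \<notin> cbox a b" for y
    using that cball_subset_cube[of y R] assms(2) by (force simp: a_def b_def)
  have "integral UNIV (\<lambda>y. G (y + c)) = integral (cbox (a - c) (b - c)) (\<lambda>y. G (y + c))"
  proof (rule integrable_compact_support(2))
    show "continuous_on UNIV (\<lambda>y. G (y + c))"
      by (intro continuous_on_compose2[OF assms(1)] continuous_intros) auto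
    show "G (y + c) = 0" if "y \<notin> cbox (a - c) (b - c)" for y
      using that by (intro out) (auto simp: mem_box algebra_simps)
  qed
  also have "\<dots> = integral (cbox a b) G"
    by (rule integral_shift_cbox)
  also have "\<dots> = integral UNIV G"
    using integrable_compact_support(2)[OF assms(1) out] by simp
  finally show ?thesis .
qed

lemma has_vector_derivative_along_line:
  fixes G :: "'a::real_vector \<Rightarrow> 'b::real_normed_vector"
  assumes "((\<lambda>r. G (y + s *\<^sub>R v + r *\<^sub>R v)) has_vector_derivative d) (at 0)"
  shows "((\<lambda>s. G (y + s *\<^sub>R v)) has_vector_derivative d) (at s within X)"
proof -
  have eq: "y + s *\<^sub>R v + (r - s) *\<^sub>R v = y + r *\<^sub>R v" for r
    by (simp add: scaleR_diff_left)
  have shift: "((\<lambda>r. r - s) has_vector_derivative 1) (at s)"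
    by (auto intro!: derivative_eq_intros)
  have "((\<lambda>r. G (y + s *\<^sub>R v + r *\<^sub>R v)) has_vector_derivative d) (at (s - s))"
    using assms by simp
  from vector_diff_chain_at[OF shift this]
  have "((\<lambda>s. G (y + s *\<^sub>R v)) has_vector_derivative d) (at s)"
    by (simp add: o_def eq)
  then show ?thesis
    by (rule has_vector_derivative_at_within)
qed

text \<open>By translation invariance \<open>s \<mapsto> \<integral> G (y + s v) dy\<close> is constant; differentiating it under the
  integral sign gives the claim.\<close>

lemma integral_partial_derivative_compact_support:
  fixes G :: "'a::euclidean_space \<Rightarrow> 'b::euclidean_space"
  assumes "continuous_on UNIV G" "continuous_on UNIV G'"
    and supp: "\<And>y. norm y > R \<Longrightarrow> G y = 0" "\<And>y. norm y > R \<Longrightarrow> G' y = 0"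
    and deriv: "\<And>y. ((\<lambda>s. G (y + s *\<^sub>R v)) has_vector_derivative G' y) (at 0)"
  shows "integral UNIV G' = 0"
proof -
  define S where "S = R + norm v"
  define a b :: 'a where "a = - S *\<^sub>R One" and "b = S *\<^sub>R One"
  have deriv': "((\<lambda>s. G (y + s *\<^sub>R v)) has_vector_derivative G' (y + s *\<^sub>R v)) (at s within X)" for y s X
    using deriv by (rule has_vector_derivative_along_line)
  have cont: "continuous_on UNIV (\<lambda>y. G (y + s *\<^sub>R v))" for s
    by (intro continuous_on_compose2[OF assms(1)] continuous_intros) auto
  have out: "norm (y + s *\<^sub>R v) > R" if "norm y > S" "s \<in> {-1..1}" for s y
  proof -
    have "norm (s *\<^sub>R v) \<le> norm v"
      using that by (auto intro!: mult_left_le_one_le)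
    moreover have "norm y \<le> norm (y + s *\<^sub>R v) + norm (s *\<^sub>R v)"
      using norm_triangle_ineq4[of "y + s *\<^sub>R v" "s *\<^sub>R v"] by simp
    ultimately show ?thesis using that by (simp add: S_def)
  qed
  have const: "integral (cbox a b) (\<lambda>y. G (y + s *\<^sub>R v)) = integral UNIV G" if "s \<in> {-1..1}" for s
  proof -
    have "integral UNIV (\<lambda>y. G (y + s *\<^sub>R v)) = integral (cbox a b) (\<lambda>y. G (y + s *\<^sub>R v))"
      unfolding a_def b_def using out that supp by (intro integrable_ball_support cont) auto
    then show ?thesis using integral_UNIV_translation[OF assms(1) supp(1)] by metis
  qed
  have "((\<lambda>s. integral (cbox a b) (\<lambda>y. G (y + s *\<^sub>R v))) has_vector_derivative
      integral (cbox a b) (\<lambda>y. G' (y + 0 *\<^sub>R v))) (at 0 within {-1..1})"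
  proof (rule leibniz_rule_vector_derivative)
    show "continuous_on ({-1..1} \<times> cbox a b) (\<lambda>(s, y). G' (y + s *\<^sub>R v))"
      unfolding split_beta by (intro continuous_on_compose2[OF assms(2)] continuous_intros) auto
    show "(\<lambda>y. G (y + s *\<^sub>R v)) integrable_on cbox a b" for s
      using cont by (meson continuous_on_subset integrable_continuous top_greatest)
  qed (auto intro: deriv')
  then have "((\<lambda>s. integral UNIV G) has_vector_derivative
      integral (cbox a b) (\<lambda>y. G' (y + 0 *\<^sub>R v))) (at 0 within {-1..1})"
    by (rule has_vector_derivative_transform[rotated 2]) (auto simp: const)
  then have "((\<lambda>s. integral UNIV G) has_vector_derivative
      integral (cbox a b) (\<lambda>y. G' (y + 0 *\<^sub>R v))) (at 0)"
    by (simp add: at_within_Icc_at)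
  moreover have "integral (cbox a b) (\<lambda>y. G' (y + 0 *\<^sub>R v)) = integral UNIV G'"
    unfolding a_def b_def using out[of _ 0] supp(2) by (subst integrable_ball_support(2)[OF assms(2)]) auto
  ultimately show ?thesis
    using vector_derivative_at[OF has_vector_derivative_const, of "integral UNIV G" "0::real"] vector_derivative_at by force
qed

section \<open>Functions with continuous partial derivatives\<close>

text \<open>For each coordinate direction \<open>b\<close>, the function \<open>F' b\<close> is the partial derivative of \<open>F\<close> along \<open>b\<close>.
  Only derivatives along the coordinate lines are requested, since these are what composition with a
  projection produces directly.\<close>

definition has_partials :: "('a::euclidean_space \<Rightarrow> 'b::euclidean_space) \<Rightarrow> ('a \<Rightarrow> 'a \<Rightarrow> 'b) \<Rightarrow> 'a set \<Rightarrow> bool" where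
  "has_partials F F' U \<longleftrightarrow>
     (\<forall>b\<in>Basis. (\<forall>x\<in>U. ((\<lambda>s. F (x + s *\<^sub>R b)) has_vector_derivative F' b x) (at 0)) \<and>
                continuous_on U (F' b))"

text \<open>On a small ball the partial derivatives are bounded. Moving from \<open>x\<close> to \<open>x + h\<close> one coordinate at a
  time and applying the mean value inequality to each move bounds the increment by a multiple of the
  sum of the \<open>\<bar>h \<bullet> b\<bar>\<close>.\<close>

lemma has_partials_imp_continuous_on:
  fixes F :: "'a::euclidean_space \<Rightarrow> 'b::euclidean_space"
  assumes "open U" and F: "has_partials F F' U"
  shows "continuous_on U F"
proof -
  have "isCont F x" if "x \<in> U" for x
  proof -
    obtain r where r: "r > 0" "cball x r \<subseteq> U"
      using open_contains_cball_eq[OF \<open>open U\<close>] \<open>x \<in> U\<close> by auto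
    have "\<exists>M. \<forall>y\<in>cball x r. norm (F' b y) \<le> M" if "b \<in> Basis" for b
    proof -
      have "compact (F' b ` cball x r)"
        using F that r(2) unfolding has_partials_def
        by (meson compact_cball compact_continuous_image continuous_on_subset)
      then show ?thesis
        by (metis bounded_iff compact_imp_bounded imageI)
    qed
    then obtain M where M: "\<And>b y. b \<in> Basis \<Longrightarrow> y \<in> cball x r \<Longrightarrow> norm (F' b y) \<le> M b"
      by metis
    define B where "B = (\<Sum>b\<in>Basis. \<bar>M b\<bar>)"
    have B: "norm (F' b y) \<le> B" if "b \<in> Basis" "y \<in> cball x r" for b y
    proof -
      have "\<bar>M b\<bar> \<le> B"
        unfolding B_def using that by (intro member_le_sum) auto
      then show ?thesis using M[OF that] by linarith
    qed
    define N where "N h = (\<Sum>b\<in>Basis. \<bar>h \<bullet> b\<bar>)" for h :: 'a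
    \<comment> \<open>The partial sums over \<open>A\<close> are the corners of the path that changes one coordinate at a time.\<close>
    have step: "norm (F (x + (\<Sum>b\<in>A. (h \<bullet> b) *\<^sub>R b)) - F x) \<le> B * (\<Sum>b\<in>A. \<bar>h \<bullet> b\<bar>)"
      if h: "N h \<le> r" and "A \<subseteq> Basis" for h A
    proof -
      have "finite A" using that(2) finite_Basis finite_subset by blast
      then show ?thesis using that(2)
      proof (induction A rule: finite_induct)
        case empty
        then show ?case by simp
      next
        case (insert b A)
        define z where "z = x + (\<Sum>b\<in>A. (h \<bullet> b) *\<^sub>R b)"
        have b: "b \<in> Basis" using insert.prems by auto
        have mem: "z + s *\<^sub>R b \<in> cball x r" if "\<bar>s\<bar> \<le> \<bar>h \<bullet> b\<bar>" for s
        proof -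
          have "norm (\<Sum>b\<in>A. (h \<bullet> b) *\<^sub>R b) \<le> (\<Sum>b\<in>A. \<bar>h \<bullet> b\<bar>)"
            using insert.prems by (intro sum_norm_le) auto
          moreover have "norm (s *\<^sub>R b) \<le> \<bar>h \<bullet> b\<bar>"
            using that b by simp
          ultimately have "norm ((\<Sum>b\<in>A. (h \<bullet> b) *\<^sub>R b) + s *\<^sub>R b) \<le> (\<Sum>b\<in>insert b A. \<bar>h \<bullet> b\<bar>)"
            using insert.hyps norm_triangle_le[of "(\<Sum>b\<in>A. (h \<bullet> b) *\<^sub>R b)" "s *\<^sub>R b"]
            by (simp add: add_mono)
          also have "\<dots> \<le> N h"
            unfolding N_def using insert.prems by (intro sum_mono2) auto
          finally have "norm ((\<Sum>b\<in>A. (h \<bullet> b) *\<^sub>R b) + s *\<^sub>R b) \<le> r"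
            using h by simp
          moreover have "x + w \<in> cball x r" if "norm w \<le> r" for w
            using that by (simp add: dist_norm)
          ultimately show ?thesis
            unfolding z_def add.assoc by blast
        qed
        have der: "((\<lambda>s. F (z + s *\<^sub>R b)) has_derivative (\<lambda>d. d *\<^sub>R F' b (z + s *\<^sub>R b))) (at s within X)"
          if "\<bar>s\<bar> \<le> \<bar>h \<bullet> b\<bar>" for s X
        proof -
          have "((\<lambda>r. F (z + s *\<^sub>R b + r *\<^sub>R b)) has_vector_derivative F' b (z + s *\<^sub>R b)) (at 0)"
            using F b mem[OF that] r(2) by (auto simp: has_partials_def)
          then show ?thesis
            using has_vector_derivative_along_line[of F z s b _ X]
            unfolding has_vector_derivative_def by blast
        qed
        have "norm (F (z + (h \<bullet> b) *\<^sub>R b) - F (z + 0 *\<^sub>R b)) \<le> B * norm (h \<bullet> b - 0)"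
        proof (rule differentiable_bound[where S = "{s. \<bar>s\<bar> \<le> \<bar>h \<bullet> b\<bar>}"])
          have "{s. \<bar>s\<bar> \<le> \<bar>h \<bullet> b\<bar>} = {- \<bar>h \<bullet> b\<bar> .. \<bar>h \<bullet> b\<bar>}"
            by (auto simp: abs_le_iff)
          then show "convex {s. \<bar>s\<bar> \<le> \<bar>h \<bullet> b\<bar>}" by simp
          show "onorm (\<lambda>d. d *\<^sub>R F' b (z + s *\<^sub>R b)) \<le> B" if "s \<in> {s. \<bar>s\<bar> \<le> \<bar>h \<bullet> b\<bar>}" for s
            using B[OF b mem, of s] that
            by (intro onorm_le) (simp add: mult.commute[of B] mult_left_mono)
        qed (use der in auto)
        moreover have "norm (F z - F x) \<le> B * (\<Sum>b\<in>A. \<bar>h \<bullet> b\<bar>)"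
          using insert by (simp add: z_def)
        moreover have eq: "x + (\<Sum>b\<in>insert b A. (h \<bullet> b) *\<^sub>R b) = z + (h \<bullet> b) *\<^sub>R b"
          using insert.hyps by (simp add: z_def)
        ultimately show ?case
          unfolding eq using insert.hyps norm_triangle_ineq[of "F (z + (h \<bullet> b) *\<^sub>R b) - F z" "F z - F x"]
          by (simp add: distrib_left)
      qed
    qed
    have N0: "(N \<longlongrightarrow> 0) (at 0)"
    proof -
      have "isCont N 0" unfolding N_def by (intro continuous_intros)
      then show ?thesis by (simp add: isCont_def N_def)
    qed
    have "((\<lambda>h. F (x + h) - F x) \<longlongrightarrow> 0) (at 0)"
    proof (rule Lim_null_comparison)
      have "\<forall>\<^sub>F h in at 0. N h < r"
        using N0 r(1) by (rule order_tendstoD)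
      then show "\<forall>\<^sub>F h in at 0. norm (F (x + h) - F x) \<le> B * N h"
      proof eventually_elim
        case (elim h)
        then show ?case using step[of h Basis] by (simp add: euclidean_representation N_def)
      qed
      show "((\<lambda>h. B * N h) \<longlongrightarrow> 0) (at 0)"
        using tendsto_mult_right_zero[OF N0] by simp
    qed
    then show ?thesis
      by (simp add: isCont_iff LIM_zero_iff)
  qed
  then show ?thesis by (simp add: continuous_at_imp_continuous_on)
qed

section \<open>The weight and integration by parts\<close>

text \<open>Up to normalization, the squares of these functions are the radial weights of the mean value
  property. The square is the least integer power that is continuously differentiable, also in \<open>t\<close>, and being
  polynomial inside the ball it makes all derivatives explicit.\<close>

definition bump :: "real \<Rightarrow> 'a::real_inner \<Rightarrow> real" where
  "bump t y = max 0 (t\<^sup>2 - y \<bullet> y)"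

lemma bump_nonneg [simp]: "bump t y \<ge> 0"
  by (simp add: bump_def)

lemma bump_eq_0: "\<bar>t\<bar> \<le> norm y \<Longrightarrow> bump t y = 0"
  using power_mono[of "\<bar>t\<bar>" "norm y" 2] by (simp add: bump_def dot_square_norm)

lemma bump_le: "bump t y \<le> t\<^sup>2"
  by (simp add: bump_def)

lemma bump_pos: "norm y < t \<Longrightarrow> bump t y > 0"
  using power_strict_mono[of "norm y" t 2] by (simp add: bump_def dot_square_norm)

lemma continuous_on_bump [continuous_intros]:
  assumes "continuous_on S f" "continuous_on S g"
  shows "continuous_on S (\<lambda>x. bump (f x) (g x))"
  unfolding bump_def by (intro continuous_intros assms)

lemma has_derivative_pos_part_square:
  "((\<lambda>w::real. (max 0 w)\<^sup>2) has_real_derivative 2 * max 0 w) (at w)"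
proof -
  consider "w > 0" | "w < 0" | "w = 0" by linarith
  then show ?thesis
  proof cases
    case 1
    have "((\<lambda>w. w\<^sup>2) has_real_derivative 2 * w) (at w)"
      by (auto intro!: derivative_eq_intros)
    moreover have "\<forall>\<^sub>F w in nhds w. (max 0 w)\<^sup>2 = w\<^sup>2"
      using eventually_nhds_in_open[of "{0<..}" w] 1 by (auto elim!: eventually_mono)
    ultimately show ?thesis
      using 1 DERIV_cong_ev[of w w "\<lambda>w. (max 0 w)\<^sup>2" "\<lambda>w. w\<^sup>2"] by simp
  next
    case 2
    have "\<forall>\<^sub>F w in nhds w. (max 0 w)\<^sup>2 = 0"
      using eventually_nhds_in_open[of "{..<0}" w] 2 by (auto elim!: eventually_mono)
    then show ?thesis
      using 2 DERIV_cong_ev[of w w "\<lambda>w. (max 0 w)\<^sup>2" "\<lambda>w. 0"] by simp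
  next
    case 3
    have "(\<lambda>h::real. ((max 0 h)\<^sup>2) / h) \<midarrow>0\<rightarrow> 0"
    proof (rule Lim_null_comparison)
      show "\<forall>\<^sub>F h in at 0. norm ((max 0 h)\<^sup>2 / h) \<le> \<bar>h\<bar>"
        by (rule always_eventually) (auto simp: max_def power2_eq_square)
      show "((\<lambda>h::real. \<bar>h\<bar>) \<longlongrightarrow> 0) (at 0)"
        by (rule tendsto_rabs_zero) simp
    qed
    then show ?thesis using 3 by (simp add: DERIV_def)
  qed
qed

lemma has_derivative_bump_square_line:
  "((\<lambda>s. (bump t (y + s *\<^sub>R v))\<^sup>2) has_real_derivative - 4 * (y \<bullet> v) * bump t y) (at 0)"
proof -
  have eq: "t\<^sup>2 - (y + s *\<^sub>R v) \<bullet> (y + s *\<^sub>R v) = t\<^sup>2 - y \<bullet> y - 2 * s * (y \<bullet> v) - s\<^sup>2 * (v \<bullet> v)" for s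
    by (simp add: algebra_simps inner_commute power2_eq_square)
  have "((\<lambda>s. t\<^sup>2 - (y + s *\<^sub>R v) \<bullet> (y + s *\<^sub>R v)) has_real_derivative - 2 * (y \<bullet> v)) (at 0)"
    unfolding eq by (auto intro!: derivative_eq_intros)
  from DERIV_chain2[OF has_derivative_pos_part_square this]
  show ?thesis by (simp add: bump_def mult_ac)
qed

lemma has_derivative_bump_line:
  "((\<lambda>s. ((y + s *\<^sub>R v) \<bullet> i) * (bump t (y + s *\<^sub>R v))\<^sup>2) has_real_derivative
     (v \<bullet> i) * (bump t y)\<^sup>2 - 4 * (y \<bullet> i) * (y \<bullet> v) * bump t y) (at 0)"
proof -
  have "((\<lambda>s. (y + s *\<^sub>R v) \<bullet> i) has_real_derivative (v \<bullet> i)) (at 0)"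
    by (auto intro!: derivative_eq_intros simp: inner_add_left)
  from DERIV_mult[OF this has_derivative_bump_square_line[of t y v]] 
  show ?thesis by (simp add: algebra_simps)
qed

text \<open>Nothing is said about \<open>F\<close> outside \<open>U\<close>; the values there are multiplied by zero. This lets
  functions given on a ball be treated as functions on the whole space.\<close>

lemma continuous_cutoff:
  fixes F :: "'a::euclidean_space \<Rightarrow> 'b::euclidean_space"
  assumes "open U" "cball x t \<subseteq> U" "continuous_on U F"
    and "continuous_on UNIV \<phi>" and "\<And>y. norm y \<ge> t \<Longrightarrow> \<phi> y = (0::real)"
  shows "continuous_on UNIV (\<lambda>y. \<phi> y *\<^sub>R F (x + y))"
proof -
  define V where "V = (\<lambda>y. x + y) -` U"
  have "open V"
    unfolding V_def using \<open>open U\<close> by (intro open_vimage continuous_intros)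
  moreover have "open {y::'a. t < norm y}"
    by (intro open_Collect_less continuous_intros)
  moreover have "continuous_on V (\<lambda>y. \<phi> y *\<^sub>R F (x + y))"
    using assms(4) by (intro continuous_intros continuous_on_compose2[OF assms(3)])
      (auto simp: V_def intro: continuous_on_subset)
  moreover have "continuous_on {y. t < norm y} (\<lambda>y. \<phi> y *\<^sub>R F (x + y))"
    by (rule continuous_on_eq[of _ "\<lambda>y. 0"]) (auto simp: assms(5))
  ultimately have "continuous_on (V \<union> {y. t < norm y}) (\<lambda>y. \<phi> y *\<^sub>R F (x + y))"
    by (rule continuous_on_open_Un)
  moreover have "y \<in> V" if "\<not> t < norm y" for y
    using assms(2) that by (auto simp: V_def dist_norm)
  then have "V \<union> {y. t < norm y} = UNIV" by auto
  ultimately show ?thesis by simp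
qed

lemma integration_by_parts_cutoff:
  fixes F :: "'a::euclidean_space \<Rightarrow> 'b::euclidean_space" and \<phi> \<phi>' :: "'a \<Rightarrow> real"
  assumes "open U" "cball x t \<subseteq> U" and F: "has_partials F F' U" and v: "v \<in> Basis"
    and cont: "continuous_on UNIV \<phi>" "continuous_on UNIV \<phi>'"
    and supp: "\<And>y. norm y \<ge> t \<Longrightarrow> \<phi> y = 0" "\<And>y. norm y \<ge> t \<Longrightarrow> \<phi>' y = 0"
    and der: "\<And>y. ((\<lambda>s. \<phi> (y + s *\<^sub>R v)) has_real_derivative \<phi>' y) (at 0)"
  shows "integral UNIV (\<lambda>y. \<phi>' y *\<^sub>R F (x + y)) = - integral UNIV (\<lambda>y. \<phi> y *\<^sub>R F' v (x + y))"
proof -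
  have F': "continuous_on U (F' v)" using F v by (auto simp: has_partials_def)
  have cF: "continuous_on U F" using has_partials_imp_continuous_on assms(1) F by blast
  have c1: "continuous_on UNIV (\<lambda>y. \<phi> y *\<^sub>R F (x + y))"
    and c2: "continuous_on UNIV (\<lambda>y. \<phi> y *\<^sub>R F' v (x + y))"
    and c3: "continuous_on UNIV (\<lambda>y. \<phi>' y *\<^sub>R F (x + y))"
    using continuous_cutoff[OF assms(1,2)] F' cF cont supp by blast+
  have i2: "(\<lambda>y. \<phi> y *\<^sub>R F' v (x + y)) integrable_on UNIV"
    using integrable_ball_support(1)[OF c2, of t] supp by auto
  have i3: "(\<lambda>y. \<phi>' y *\<^sub>R F (x + y)) integrable_on UNIV"
    using integrable_ball_support(1)[OF c3, of t] supp by auto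
  have "integral UNIV (\<lambda>y. \<phi> y *\<^sub>R F' v (x + y) + \<phi>' y *\<^sub>R F (x + y)) = 0"
  proof (rule integral_partial_derivative_compact_support[OF c1 continuous_on_add[OF c2 c3], where R = t])
    fix y
    show "((\<lambda>s. \<phi> (y + s *\<^sub>R v) *\<^sub>R F (x + (y + s *\<^sub>R v))) has_vector_derivative
        \<phi> y *\<^sub>R F' v (x + y) + \<phi>' y *\<^sub>R F (x + y)) (at 0)"
    proof (cases "x + y \<in> U")
      case True
      then have "((\<lambda>s. F (x + (y + s *\<^sub>R v))) has_vector_derivative F' v (x + y)) (at 0)"
        using F v unfolding has_partials_def add.assoc[symmetric] by blast
      from has_vector_derivative_scaleR[OF der this] show ?thesis by simp
    next
      case False
      then have y: "norm y > t" using assms(2) by (force simp: dist_norm)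
      have "open {s::real. t < norm (y + s *\<^sub>R v)}"
        by (intro open_Collect_less continuous_intros)
      then have "((\<lambda>s. \<phi> (y + s *\<^sub>R v) *\<^sub>R F (x + (y + s *\<^sub>R v))) has_vector_derivative 0) (at 0)"
        by (rule has_vector_derivative_transform_within_open[OF has_vector_derivative_const[of 0]])
          (use y supp(1) in auto)
      then show ?thesis using y supp by simp
    qed
  qed (use supp in auto)
  then show ?thesis
    using integral_add[OF i2 i3] by (simp add: eq_neg_iff_add_eq_0 add.commute[of "integral UNIV (\<lambda>y. \<phi>' y *\<^sub>R F (x + y))"])
qed

lemma bump_integration_by_parts:
  fixes F :: "'a::euclidean_space \<Rightarrow> 'b::euclidean_space"
  assumes "open U" "t > 0" "cball x t \<subseteq> U" "has_partials F F' U" "i \<in> Basis" "j \<in> Basis"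
  shows "integral UNIV (\<lambda>y. ((j \<bullet> i) * (bump t y)\<^sup>2 - 4 * (y \<bullet> i) * (y \<bullet> j) * bump t y) *\<^sub>R F (x + y)) =
       - integral UNIV (\<lambda>y. ((y \<bullet> i) * (bump t y)\<^sup>2) *\<^sub>R F' j (x + y))"
  by (rule integration_by_parts_cutoff[OF assms(1,3,4,6)])
    (use assms(2) in \<open>auto simp: bump_eq_0 intro!: continuous_intros has_derivative_bump_line\<close>)

section \<open>The mean value property\<close>

definition bump_mass :: "'a::euclidean_space itself \<Rightarrow> real \<Rightarrow> real" where
  "bump_mass _ t = integral UNIV (\<lambda>y::'a. (bump t y)\<^sup>2)"

text \<open>The classical mean value property of harmonic functions with the radial weight \<open>u\<^sub>t\<^sup>2\<close> in place of
  the surface measure of a sphere.\<close>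

definition bump_mean_value :: "('a::euclidean_space \<Rightarrow> 'b::euclidean_space) \<Rightarrow> 'a set \<Rightarrow> bool" where
  "bump_mean_value F U \<longleftrightarrow> continuous_on U F \<and>
     (\<forall>x t. 0 < t \<longrightarrow> cball x t \<subseteq> U \<longrightarrow>
        integral UNIV (\<lambda>y. (bump t y)\<^sup>2 *\<^sub>R F (x + y)) = bump_mass TYPE('a) t *\<^sub>R F x)"

text \<open>Put \<open>I\<^sub>k(t) = \<integral> u\<^sub>t(y)\<^sup>k F(x + y) dy\<close> and let \<open>N = n + 4\<close> for the dimension \<open>n\<close>. The hypothesis says
  \<open>N I\<^sub>2 = 4 t\<^sup>2 I\<^sub>1\<close>, while differentiating the weight in \<open>t\<close> gives \<open>I\<^sub>2' = 4 t I\<^sub>1\<close>. Hence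
  \<open>t I\<^sub>2' = N I\<^sub>2\<close>, so \<open>I\<^sub>2 / t\<^sup>N\<close> is constant.\<close>

lemma bump_square_integral_scaling:
  fixes F :: "'a::euclidean_space \<Rightarrow> 'b::euclidean_space"
  assumes cont: "continuous_on (cball x R) F" and "R > 0"
    and weak: "\<And>t. 0 < t \<Longrightarrow> t \<le> R \<Longrightarrow>
      integral UNIV (\<lambda>y. (real (DIM('a) + 4) * (bump t y)\<^sup>2 - 4 * t\<^sup>2 * bump t y) *\<^sub>R F (x + y)) = 0"
  obtains c where "\<And>t. 0 < t \<Longrightarrow> t \<le> R \<Longrightarrow>
      integral UNIV (\<lambda>y. (bump t y)\<^sup>2 *\<^sub>R F (x + y)) = t ^ (DIM('a) + 4) *\<^sub>R c"
proof -
  define N where "N = DIM('a) + 4"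
  \<comment> \<open>A continuous extension of \<open>F\<close> from the ball; it makes differentiation under the integral over a box
    possible and does not change the weighted integrals.\<close>
  define E where "E y = F (closest_point (cball x R) (x + y))" for y
  have "continuous_on UNIV (closest_point (cball x R))"
    using \<open>R > 0\<close> by (intro continuous_on_closest_point) auto
  moreover have "closest_point (cball x R) y \<in> cball x R" for y
    using \<open>R > 0\<close> by (intro closest_point_in_set) auto
  ultimately have "continuous_on UNIV (\<lambda>y. F (closest_point (cball x R) y))"
    by (intro continuous_on_compose2[OF cont]) auto
  then have contE: "continuous_on UNIV E"
    unfolding E_def by (rule continuous_on_compose2) (auto intro!: continuous_intros)
  have E: "E y = F (x + y)" if "norm y \<le> R" for y
    using that by (simp add: E_def closest_point_self dist_norm)
  define a b :: 'a where "a = - R *\<^sub>R One" and "b = R *\<^sub>R One"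
  define I where "I k t = integral (cbox a b) (\<lambda>y. (bump t y) ^ k *\<^sub>R E y)" for k t
  have contb: "continuous_on UNIV (\<lambda>y. (bump t y) ^ k *\<^sub>R E y)" for k t
    by (intro continuous_intros contE)
  have integrable: "(\<lambda>y. (bump t y) ^ k *\<^sub>R E y) integrable_on cbox a b" for k t
    using contb by (meson continuous_on_subset integrable_continuous top_greatest)
  have E2: "(bump t y) ^ k *\<^sub>R F (x + y) = (bump t y) ^ k *\<^sub>R E y" if "0 < t" "t \<le> R" "k > 0" for k t y
    using E[of y] bump_eq_0[of t y] that by (cases "norm y \<le> R") auto
  have I: "integral UNIV (\<lambda>y. (bump t y) ^ k *\<^sub>R F (x + y)) = I k t"
    and Int: "(\<lambda>y. (bump t y) ^ k *\<^sub>R F (x + y)) integrable_on UNIV"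
    if t: "0 < t" "t \<le> R" "k > 0" for k t
  proof -
    have *: "(\<lambda>y. (bump t y) ^ k *\<^sub>R F (x + y)) = (\<lambda>y. (bump t y) ^ k *\<^sub>R E y)"
      using E2[OF t] by auto
    have "bump t y ^ k *\<^sub>R E y = 0" if "norm y > R" for y
      using t that by (simp add: bump_eq_0)
    then show "integral UNIV (\<lambda>y. (bump t y) ^ k *\<^sub>R F (x + y)) = I k t"
      "(\<lambda>y. (bump t y) ^ k *\<^sub>R F (x + y)) integrable_on UNIV"
      unfolding * I_def a_def b_def using integrable_ball_support[OF contb] by auto
  qed
  have rel: "real N *\<^sub>R I 2 t = (4 * t\<^sup>2) *\<^sub>R I 1 t" if t: "0 < t" "t \<le> R" for t
  proof -
    have i1: "(\<lambda>y. (4 * t\<^sup>2) *\<^sub>R bump t y ^ 1 *\<^sub>R F (x + y)) integrable_on UNIV"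
      and i2: "(\<lambda>y. real N *\<^sub>R (bump t y)\<^sup>2 *\<^sub>R F (x + y)) integrable_on UNIV"
      using Int[OF t, of 1] Int[OF t, of 2] by (intro integrable_cmul; simp)+
    have "0 = integral UNIV (\<lambda>y. real N *\<^sub>R (bump t y)\<^sup>2 *\<^sub>R F (x + y) - (4 * t\<^sup>2) *\<^sub>R bump t y ^ 1 *\<^sub>R F (x + y))"
      using weak[OF t] by (simp add: N_def scaleR_diff_left)
    also have "\<dots> = real N *\<^sub>R I 2 t - (4 * t\<^sup>2) *\<^sub>R I 1 t"
      unfolding integral_diff[OF i2 i1] integral_cmul using I[OF t, of 1] I[OF t, of 2] by simp
    finally show ?thesis by simp
  qed
  have dI: "(I 2 has_vector_derivative (4 * t) *\<^sub>R I 1 t) (at t within {0<..R})" if "t \<in> {0<..R}" for t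
  proof -
    have "((\<lambda>t. integral (cbox a b) (\<lambda>y. (bump t y)\<^sup>2 *\<^sub>R E y)) has_vector_derivative
       integral (cbox a b) (\<lambda>y. (4 * t * bump t y) *\<^sub>R E y)) (at t within {0<..R})"
    proof (rule leibniz_rule_vector_derivative)
      fix t :: real and y :: 'a
      have "((\<lambda>t. t\<^sup>2 - y \<bullet> y) has_real_derivative 2 * t) (at t within {0<..R})"
        by (auto intro!: derivative_eq_intros)
      from DERIV_chain2[OF has_derivative_pos_part_square this]
      have "((\<lambda>t. (bump t y)\<^sup>2) has_real_derivative 4 * t * bump t y) (at t within {0<..R})"
        by (simp add: bump_def mult_ac)
      from has_vector_derivative_scaleR[OF this has_vector_derivative_const]
      show "((\<lambda>t. (bump t y)\<^sup>2 *\<^sub>R E y) has_vector_derivative (4 * t * bump t y) *\<^sub>R E y) (at t within {0<..R})"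
        by simp
    next
      show "continuous_on ({0<..R} \<times> cbox a b) (\<lambda>(t, y). (4 * t * bump t y) *\<^sub>R E y)"
        unfolding split_beta by (intro continuous_intros continuous_on_compose2[OF contE]) auto
    qed (use that integrable in auto)
    then show ?thesis
      unfolding I_def by (simp flip: scaleR_scaleR)
  qed
  have "((\<lambda>t. (inverse t ^ N) *\<^sub>R I 2 t) has_vector_derivative 0) (at t within {0<..R})"
    if t: "t \<in> {0<..R}" for t
  proof -
    have "((\<lambda>t. inverse t ^ N) has_real_derivative - (real N * inverse t ^ (N + 1))) (at t within {0<..R})"
    proof -
      have N: "N = Suc (N - 1)" by (simp add: N_def)
      have "inverse t ^ (N + 1) = inverse t ^ (N - 1) * (inverse t * inverse t)"
        by (subst N) simp
      then show ?thesis
        using t by (auto intro!: derivative_eq_intros)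
    qed
    from has_vector_derivative_scaleR[OF this dI[OF t]]
    have "((\<lambda>t. (inverse t ^ N) *\<^sub>R I 2 t) has_vector_derivative
        (inverse t ^ N) *\<^sub>R ((4 * t) *\<^sub>R I 1 t) - inverse t ^ (N + 1) *\<^sub>R real N *\<^sub>R I 2 t) (at t within {0<..R})"
      by (simp add: mult.commute)
    also have "real N *\<^sub>R I 2 t = (4 * t\<^sup>2) *\<^sub>R I 1 t"
      using rel t by simp
    also have "(inverse t ^ N) *\<^sub>R ((4 * t) *\<^sub>R I 1 t) - inverse t ^ (N + 1) *\<^sub>R ((4 * t\<^sup>2) *\<^sub>R I 1 t) = 0"
      using t by (simp add: power2_eq_square)
    finally show ?thesis .
  qed
  then obtain c where c: "\<And>t. t \<in> {0<..R} \<Longrightarrow> (inverse t ^ N) *\<^sub>R I 2 t = c"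
    using has_vector_derivative_zero_constant[of "{0<..R}" "\<lambda>t. (inverse t ^ N) *\<^sub>R I 2 t"]
    by (auto simp: convex_real_interval)
  show ?thesis
  proof (rule that)
    fix t assume t: "0 < t" "t \<le> R"
    have "integral UNIV (\<lambda>y. (bump t y)\<^sup>2 *\<^sub>R F (x + y)) = I 2 t"
      using I[OF t] by simp
    also have "\<dots> = t ^ N *\<^sub>R ((inverse t ^ N) *\<^sub>R I 2 t)"
      using t by (simp add: power_mult_distrib[symmetric])
    also have "(inverse t ^ N) *\<^sub>R I 2 t = c"
      using c t by simp
    finally show "integral UNIV (\<lambda>y. (bump t y)\<^sup>2 *\<^sub>R F (x + y)) = t ^ (DIM('a) + 4) *\<^sub>R c"
      by (simp add: N_def)
  qed
qed

text \<open>The functions \<open>\<delta>\<^sub>i\<^sub>j u\<^sub>t\<^sup>2 - 4 y\<^sub>i y\<^sub>j u\<^sub>t\<close> are the partial derivatives of \<open>y\<^sub>i u\<^sub>t\<^sup>2\<close>, that is, a multiple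
  of the Hessian of \<open>u\<^sub>t\<^sup>3\<close>. The diagonal ones add up to the Laplacian, which is simplified here by
  \<open>|y|\<^sup>2 u\<^sub>t = (t\<^sup>2 - u\<^sub>t) u\<^sub>t\<close>.\<close>

lemma weak_laplace_bump:
  fixes F :: "'a::euclidean_space \<Rightarrow> 'b::euclidean_space"
  assumes "open U" "cball x t \<subseteq> U" "t > 0" "continuous_on U F"
    and "(\<Sum>i\<in>Basis. integral UNIV (\<lambda>y. ((i \<bullet> i) * (bump t y)\<^sup>2 - 4 * (y \<bullet> i) * (y \<bullet> i) * bump t y) *\<^sub>R F (x + y))) = 0"
  shows "integral UNIV (\<lambda>y. (real (DIM('a) + 4) * (bump t y)\<^sup>2 - 4 * t\<^sup>2 * bump t y) *\<^sub>R F (x + y)) = 0"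
proof -
  have int: "(\<lambda>y. ((i \<bullet> i) * (bump t y)\<^sup>2 - 4 * (y \<bullet> i) * (y \<bullet> i) * bump t y) *\<^sub>R F (x + y)) integrable_on UNIV" for i
  proof (rule integrable_ball_support(1)[where R = t])
    show "continuous_on UNIV (\<lambda>y. ((i \<bullet> i) * (bump t y)\<^sup>2 - 4 * (y \<bullet> i) * (y \<bullet> i) * bump t y) *\<^sub>R F (x + y))"
    proof (rule continuous_cutoff[OF assms(1,2,4)])
      show "continuous_on UNIV (\<lambda>y. (i \<bullet> i) * (bump t y)\<^sup>2 - 4 * (y \<bullet> i) * (y \<bullet> i) * bump t y)"
        by (intro continuous_intros)
    qed (use assms(3) in \<open>auto simp: bump_eq_0\<close>)
  qed (use assms(3) in \<open>auto simp: bump_eq_0\<close>)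
  have eq: "(real (DIM('a) + 4) * (bump t y)\<^sup>2 - 4 * t\<^sup>2 * bump t y) =
      (\<Sum>i\<in>Basis. (i \<bullet> i) * (bump t y)\<^sup>2 - 4 * (y \<bullet> i) * (y \<bullet> i) * bump t y)" for y :: 'a
  proof -
    have "(\<Sum>i\<in>Basis. (i \<bullet> i) * (bump t y)\<^sup>2 - 4 * (y \<bullet> i) * (y \<bullet> i) * bump t y) =
       (\<Sum>i\<in>(Basis::'a set). (bump t y)\<^sup>2) - (\<Sum>i\<in>Basis. 4 * bump t y * ((y \<bullet> i) * (y \<bullet> i)))"
      by (simp add: sum_subtractf mult_ac)
    also have "\<dots> = real DIM('a) * (bump t y)\<^sup>2 - 4 * bump t y * (y \<bullet> y)"
      by (simp add: sum_distrib_left[symmetric] euclidean_inner[of y y])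
    also have "bump t y * (y \<bullet> y) = bump t y * (t\<^sup>2 - bump t y)"
      by (auto simp: bump_def max_def)
    then have "4 * bump t y * (y \<bullet> y) = 4 * t\<^sup>2 * bump t y - 4 * (bump t y)\<^sup>2"
      by (simp add: algebra_simps power2_eq_square)
    finally show ?thesis by (simp add: algebra_simps)
  qed
  show ?thesis
    unfolding eq scaleR_sum_left using assms(5) int by (subst integral_sum) (auto simp del: inner_same_Basis)
qed

lemma bump_mass_integral: "integral UNIV (\<lambda>y::'a::euclidean_space. (bump t y)\<^sup>2 *\<^sub>R (c::'b::euclidean_space)) = bump_mass TYPE('a) t *\<^sub>R c"
proof -
  have "(\<lambda>y::'a. (bump t y)\<^sup>2) integrable_on UNIV"
  proof (rule integrable_ball_support(1)[where R = "\<bar>t\<bar>"])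
    show "continuous_on UNIV (\<lambda>y::'a. (bump t y)\<^sup>2)" by (intro continuous_intros)
  qed (simp add: bump_eq_0)
  then show ?thesis
    unfolding bump_mass_def
    by (intro integral_unique has_integral_scaleR_left integrable_integral)
qed

text \<open>This is the scaling lemma for the constant function \<open>1\<close>, which trivially has partial derivatives.
  It replaces a change of variables.\<close>

lemma bump_mass_scaling:
  assumes "t > 0"
  shows "bump_mass TYPE('a::euclidean_space) t = t ^ (DIM('a) + 4) * bump_mass TYPE('a) 1"
proof -
  define R where "R = max 1 t"
  have const: "has_partials (\<lambda>_. 1::real) (\<lambda>_ _. 0) (UNIV :: 'a set)"
    by (auto simp: has_partials_def)
  have weak: "integral UNIV (\<lambda>y::'a. (real (DIM('a) + 4) * (bump t y)\<^sup>2 - 4 * t\<^sup>2 * bump t y) *\<^sub>R (1::real)) = 0"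
    if "t > 0" for t :: real
  proof (rule weak_laplace_bump[of UNIV 0 t "\<lambda>_. 1"])
    show "(\<Sum>i\<in>Basis. integral UNIV (\<lambda>y::'a. ((i \<bullet> i) * (bump t y)\<^sup>2 - 4 * (y \<bullet> i) * (y \<bullet> i) * bump t y) *\<^sub>R (1::real))) = 0"
    proof (intro sum.neutral ballI)
      fix i :: 'a assume "i \<in> Basis"
      then show "integral UNIV (\<lambda>y. ((i \<bullet> i) * (bump t y)\<^sup>2 - 4 * (y \<bullet> i) * (y \<bullet> i) * bump t y) *\<^sub>R (1::real)) = 0"
        using bump_integration_by_parts[OF open_UNIV that _ const, of 0 i i] by (simp del: inner_Basis)
    qed
  qed (use that in auto)
  obtain c where c: "\<And>t. 0 < t \<Longrightarrow> t \<le> R \<Longrightarrow>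
      integral UNIV (\<lambda>y::'a. (bump t y)\<^sup>2 *\<^sub>R (1::real)) = t ^ (DIM('a) + 4) *\<^sub>R c"
    by (rule bump_square_integral_scaling[of "0::'a" R "\<lambda>_. 1::real"]) (use weak in \<open>auto simp: R_def\<close>)
  show ?thesis
    using c[of t] c[of 1] assms by (simp add: bump_mass_def R_def)
qed

lemma bump_mass_pos:
  assumes "t > 0"
  shows "bump_mass TYPE('a::euclidean_space) t > 0"
proof -
  define a b :: 'a where "a = - t *\<^sub>R One" and "b = t *\<^sub>R One"
  have cont: "continuous_on UNIV (\<lambda>y::'a. (bump t y)\<^sup>2)" by (intro continuous_intros)
  have *: "(\<lambda>y::'a. (bump t y)\<^sup>2) integrable_on UNIV"
     "bump_mass TYPE('a) t = integral (cbox a b) (\<lambda>y. (bump t y)\<^sup>2)"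
    unfolding bump_mass_def a_def b_def
    using integrable_ball_support[OF cont, of t] assms by (auto simp: bump_eq_0)
  have "bump_mass TYPE('a) t \<ge> 0"
    unfolding bump_mass_def by (rule integral_nonneg[OF *(1)]) auto
  moreover have "bump_mass TYPE('a) t \<noteq> 0"
  proof
    assume "bump_mass TYPE('a) t = 0"
    then have "((\<lambda>y. (bump t y)\<^sup>2) has_integral 0) (cbox a b)"
      using *(2) cont by (metis continuous_on_subset integrable_continuous integrable_integral top_greatest)
    moreover have "box a b \<noteq> {}"
      using assms by (simp add: box_ne_empty a_def b_def)
    ultimately have "(bump t (0::'a))\<^sup>2 = 0"
      by (intro has_integral_0_cbox_imp_0[of a b "\<lambda>y. (bump t y)\<^sup>2"] continuous_on_subset[OF cont])
         (use assms in \<open>auto simp: a_def b_def mem_box\<close>)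
    then show False
      using bump_pos[of "0::'a" t] assms by simp
  qed
  ultimately show ?thesis by simp
qed

text \<open>Weak harmonicity against the radial test functions suffices for the mean value property: the
  integrals scale like \<open>t\<^sup>n\<^sup>+\<^sup>4\<close>, and the constant of proportionality is found by letting \<open>t\<close> tend to \<open>0\<close>,
  where continuity makes \<open>F(x + y)\<close> approach \<open>F(x)\<close>.\<close>

lemma bump_mean_valueI:
  fixes F :: "'a::euclidean_space \<Rightarrow> 'b::euclidean_space"
  assumes "open U" and cont: "continuous_on U F"
    and weak: "\<And>x t. 0 < t \<Longrightarrow> cball x t \<subseteq> U \<Longrightarrow>
      (\<Sum>i\<in>Basis. integral UNIV (\<lambda>y. ((i \<bullet> i) * (bump t y)\<^sup>2 - 4 * (y \<bullet> i) * (y \<bullet> i) * bump t y) *\<^sub>R F (x + y))) = 0"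
  shows "bump_mean_value F U"
  unfolding bump_mean_value_def
proof (intro conjI allI impI)
  fix x :: 'a and R :: real
  assume R: "0 < R" "cball x R \<subseteq> U"
  define M where "M = bump_mass TYPE('a)"
  have sub: "cball x t \<subseteq> U" if "t \<le> R" for t
    using that R(2) by (meson order_trans subset_cball)
  have contR: "continuous_on (cball x R) F"
    using cont R(2) continuous_on_subset by blast
  obtain c where c: "\<And>t. 0 < t \<Longrightarrow> t \<le> R \<Longrightarrow>
      integral UNIV (\<lambda>y. (bump t y)\<^sup>2 *\<^sub>R F (x + y)) = t ^ (DIM('a) + 4) *\<^sub>R c"
    by (rule bump_square_integral_scaling[OF contR R(1)])
       (use weak_laplace_bump[OF assms(1) sub _ cont] weak sub in \<open>auto\<close>)
  have "norm (c - M 1 *\<^sub>R F x) \<le> e" if "e > 0" for e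
  proof -
    have M1: "M 1 > 0" unfolding M_def by (rule bump_mass_pos) simp
    have "isCont F x"
      using R cont \<open>open U\<close> by (auto simp: continuous_on_eq_continuous_at subset_iff)
    then obtain d where d: "d > 0" "\<And>y. dist y x < d \<Longrightarrow> dist (F y) (F x) < e / M 1"
      using \<open>e > 0\<close> M1 unfolding continuous_at_eps_delta by (metis divide_pos_pos)
    define t where "t = min R (d / 2)"
    have t: "0 < t" "t \<le> R" "t < d" using R d(1) by (auto simp: t_def)
    have cont1: "continuous_on UNIV (\<lambda>y::'a. (bump t y)\<^sup>2)" by (intro continuous_intros)
    have i0: "(\<lambda>y::'a. (bump t y)\<^sup>2) integrable_on UNIV"
      using integrable_ball_support(1)[OF cont1, of t] t by (auto simp: bump_eq_0)
    have "continuous_on UNIV (\<lambda>y. (bump t y)\<^sup>2 *\<^sub>R F (x + y))"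
      using continuous_cutoff[OF assms(1) sub cont cont1] t by (auto simp: bump_eq_0)
    then have i1: "(\<lambda>y. (bump t y)\<^sup>2 *\<^sub>R F (x + y)) integrable_on UNIV"
      using integrable_ball_support(1)[of "\<lambda>y. (bump t y)\<^sup>2 *\<^sub>R F (x + y)" t] t by (auto simp: bump_eq_0)
    have i2: "(\<lambda>y::'a. (bump t y)\<^sup>2 *\<^sub>R F x) integrable_on UNIV"
      using i0 by (rule integrable_on_scaleR_left)
    have "norm (integral UNIV (\<lambda>y. (bump t y)\<^sup>2 *\<^sub>R F (x + y) - (bump t y)\<^sup>2 *\<^sub>R F x)) \<le>
       integral UNIV (\<lambda>y::'a. (bump t y)\<^sup>2 * (e / M 1))"
    proof (rule integral_norm_bound_integral)
      show "(\<lambda>y. (bump t y)\<^sup>2 *\<^sub>R F (x + y) - (bump t y)\<^sup>2 *\<^sub>R F x) integrable_on UNIV"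
        by (rule integrable_diff[OF i1 i2])
      show "(\<lambda>y::'a. (bump t y)\<^sup>2 * (e / M 1)) integrable_on UNIV"
        using i0 by (rule integrable_on_mult_left)
      show "norm ((bump t y)\<^sup>2 *\<^sub>R F (x + y) - (bump t y)\<^sup>2 *\<^sub>R F x) \<le> (bump t y)\<^sup>2 * (e / M 1)" for y
      proof (cases "norm y < t")
        case True
        then have "norm (F (x + y) - F x) \<le> e / M 1"
          using d(2)[of "x + y"] t(3) by (simp add: dist_norm)
        then show ?thesis
          unfolding scaleR_diff_right[symmetric] norm_scaleR abs_power2
          by (rule mult_left_mono) simp
      next
        case False
        then show ?thesis using t by (simp add: bump_eq_0)
      qed
    qed
    also have "\<dots> = t ^ (DIM('a) + 4) * e"
    proof -
      have "integral UNIV (\<lambda>y::'a. (bump t y)\<^sup>2 * (e / M 1)) = M t * (e / M 1)"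
        unfolding M_def bump_mass_def by simp
      then show ?thesis
        using bump_mass_scaling[OF t(1), where 'a = 'a] M1 by (simp add: M_def)
    qed
    also have "integral UNIV (\<lambda>y. (bump t y)\<^sup>2 *\<^sub>R F (x + y) - (bump t y)\<^sup>2 *\<^sub>R F x) =
        t ^ (DIM('a) + 4) *\<^sub>R (c - M 1 *\<^sub>R F x)"
      using c[OF t(1,2)] bump_mass_scaling[OF t(1), where 'a = 'a]
      by (simp add: integral_diff[OF i1 i2] bump_mass_integral M_def scaleR_diff_right)
    finally show ?thesis
      using t(1) by simp
  qed
  then have "norm (c - M 1 *\<^sub>R F x) \<le> 0"
    by (rule field_le_epsilon) simp
  then have "c = M 1 *\<^sub>R F x" by simp
  then show "integral UNIV (\<lambda>y. (bump R y)\<^sup>2 *\<^sub>R F (x + y)) = bump_mass TYPE('a) R *\<^sub>R F x"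
    using c[of R] R(1) bump_mass_scaling[OF R(1), where 'a = 'a] by (simp add: M_def)
qed (rule cont)

section \<open>Maximum principle\<close>

lemma integrable_bump_product:
  fixes F :: "'a::euclidean_space \<Rightarrow> 'b::euclidean_space"
  assumes "open U" "0 < t" "cball x t \<subseteq> U" "continuous_on U F"
  shows "continuous_on UNIV (\<lambda>y. (bump t y)\<^sup>2 *\<^sub>R F (x + y))"
    and "(\<lambda>y. (bump t y)\<^sup>2 *\<^sub>R F (x + y)) integrable_on UNIV"
proof -
  have "continuous_on UNIV (\<lambda>y::'a. (bump t y)\<^sup>2)" by (intro continuous_intros)
  then show c: "continuous_on UNIV (\<lambda>y. (bump t y)\<^sup>2 *\<^sub>R F (x + y))"
    using assms(2) by (intro continuous_cutoff[OF assms(1,3,4)]) (auto simp: bump_eq_0)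
  show "(\<lambda>y. (bump t y)\<^sup>2 *\<^sub>R F (x + y)) integrable_on UNIV"
    using assms(2) by (intro integrable_ball_support(1)[OF c, of t]) (auto simp: bump_eq_0)
qed

text \<open>By the Cauchy--Schwarz inequality \<open>|F(x)|\<^sup>2 - \<langle>F(y), F(x)\<rangle> \<ge> 0\<close> on the ball, and the weighted mean of
  this function is \<open>0\<close>. So it vanishes identically; together with \<open>|F(y)| \<le> |F(x)|\<close> this forces
  \<open>|F(y) - F(x)|\<^sup>2 \<le> 0\<close>.\<close>

lemma bump_mean_value_norm_max_imp_const:
  fixes F :: "'a::euclidean_space \<Rightarrow> 'b::euclidean_space"
  assumes "open U" and F: "bump_mean_value F U" and "0 < t" "cball x t \<subseteq> U"
    and max: "\<And>y. y \<in> ball x t \<Longrightarrow> norm (F y) \<le> norm (F x)"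
    and y: "y \<in> ball x t"
  shows "F y = F x"
proof -
  have cF: "continuous_on U F" using F by (simp add: bump_mean_value_def)
  define w where "w z = (bump t z)\<^sup>2 *\<^sub>R (F x \<bullet> F x) - ((bump t z)\<^sup>2 *\<^sub>R F (x + z)) \<bullet> F x" for z
  have inner_le: "F z \<bullet> F x \<le> F x \<bullet> F x" if "z \<in> ball x t" for z
  proof -
    have "F z \<bullet> F x \<le> norm (F z) * norm (F x)" by (rule norm_cauchy_schwarz)
    also have "\<dots> \<le> norm (F x) * norm (F x)" using max[OF that] by (intro mult_right_mono) auto
    finally show ?thesis by (simp add: dot_square_norm power2_eq_square)
  qed
  have "continuous_on UNIV w"
    unfolding w_def by (intro continuous_intros integrable_bump_product(1)[OF assms(1,3,4) cF])
  moreover have w_nonneg: "w z \<ge> 0" for z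
  proof (cases "norm z < t")
    case True
    then have "F (x + z) \<bullet> F x \<le> F x \<bullet> F x"
      by (intro inner_le) (simp add: dist_norm)
    then have "(bump t z)\<^sup>2 * (F (x + z) \<bullet> F x) \<le> (bump t z)\<^sup>2 * (F x \<bullet> F x)"
      by (rule mult_left_mono) simp
    then show ?thesis by (simp add: w_def)
  next
    case False
    then show ?thesis using \<open>0 < t\<close> by (simp add: w_def bump_eq_0)
  qed
  moreover have "integral UNIV w = 0"
  proof -
    have i1: "(\<lambda>z. ((bump t z)\<^sup>2 *\<^sub>R F (x + z)) \<bullet> F x) integrable_on UNIV"
      and e1: "integral UNIV (\<lambda>z. ((bump t z)\<^sup>2 *\<^sub>R F (x + z)) \<bullet> F x) = (bump_mass TYPE('a) t *\<^sub>R F x) \<bullet> F x"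
    proof -
      have "(\<lambda>z. (bump t z)\<^sup>2 *\<^sub>R F (x + z)) integrable_on UNIV"
        by (rule integrable_bump_product(2)[OF assms(1,3,4) cF])
      note h = integrable_linear[OF this bounded_linear_inner_left[of "F x"]]
        integral_linear[OF this bounded_linear_inner_left[of "F x"]]
      show "(\<lambda>z. ((bump t z)\<^sup>2 *\<^sub>R F (x + z)) \<bullet> F x) integrable_on UNIV"
        using h(1) by (simp add: o_def)
      show "integral UNIV (\<lambda>z. ((bump t z)\<^sup>2 *\<^sub>R F (x + z)) \<bullet> F x) = (bump_mass TYPE('a) t *\<^sub>R F x) \<bullet> F x"
        using h(2) F assms(3,4) by (simp add: o_def bump_mean_value_def)
    qed
    have i2: "(\<lambda>z::'a. (bump t z)\<^sup>2 *\<^sub>R (F x \<bullet> F x)) integrable_on UNIV"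
      using integrable_bump_product(2)[of UNIV t 0 "\<lambda>_. F x \<bullet> F x"] \<open>0 < t\<close> by simp
    show ?thesis
      unfolding w_def integral_diff[OF i2 i1] e1 by (simp only: bump_mass_integral) simp
  qed
  moreover have wsupp: "w z = 0" if "norm z > t" for z
    using that \<open>0 < t\<close> by (simp add: w_def bump_eq_0)
  moreover have "box (- t *\<^sub>R One) (t *\<^sub>R One :: 'a) \<noteq> {}"
    using \<open>0 < t\<close> by (simp add: box_ne_empty)
  moreover have ty: "norm (y - x) < t" using y by (simp add: dist_norm norm_minus_commute)
  moreover have "(w has_integral integral UNIV w) (cbox (- t *\<^sub>R One) (t *\<^sub>R One))"
    using integrable_ball_support(2)[OF \<open>continuous_on UNIV w\<close> wsupp]
    by (metis \<open>continuous_on UNIV w\<close> continuous_on_subset integrable_continuous integrable_integral top_greatest)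
  ultimately have "w (y - x) = 0"
    by (intro has_integral_0_cbox_imp_0[of "- t *\<^sub>R One" "t *\<^sub>R One" w] cball_subset_cube)
       (auto intro: continuous_on_subset)
  moreover have "bump t (y - x) > 0" using ty by (rule bump_pos)
  ultimately have "F x \<bullet> F x = F y \<bullet> F x" by (simp add: w_def)
  then have "(F y - F x) \<bullet> (F y - F x) = F y \<bullet> F y - F x \<bullet> F x"
    by (simp add: inner_diff inner_commute)
  also have "\<dots> \<le> 0"
    using max[OF y] by (simp add: dot_square_norm power_mono)
  finally have "F y - F x = 0"
    using inner_gt_zero_iff[of "F y - F x"] by linarith
  then show ?thesis by simp
qed

section \<open>Finite differences and unique continuation\<close>

definition forward_diff :: "'a::real_vector \<Rightarrow> ('a \<Rightarrow> 'b::real_vector) \<Rightarrow> 'a \<Rightarrow> 'b" where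
  "forward_diff h F x = F (x + h) - F x"

text \<open>Newton's forward difference formula, the discrete counterpart of Taylor's expansion.\<close>

lemma newton_forward:
  "F (x + real N *\<^sub>R h) = (\<Sum>k\<le>N. real (N choose k) *\<^sub>R (forward_diff h ^^ k) F x)"
proof (induction N arbitrary: F)
  case 0
  then show ?case by simp
next
  case (Suc N)
  define T where "T k = (forward_diff h ^^ k) F x" for k
  have "F (x + real (Suc N) *\<^sub>R h) = F (x + real N *\<^sub>R h) + forward_diff h F (x + real N *\<^sub>R h)"
    by (simp add: forward_diff_def algebra_simps)
  also have "\<dots> = (\<Sum>k\<le>N. real (N choose k) *\<^sub>R T k) + (\<Sum>k\<le>N. real (N choose k) *\<^sub>R T (Suc k))"
    unfolding Suc.IH T_def by (simp add: funpow_swap1)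
  also have "(\<Sum>k\<le>N. real (N choose k) *\<^sub>R T k) = (\<Sum>k\<le>Suc N. real (N choose k) *\<^sub>R T k)"
    by simp
  also have "\<dots> = T 0 + (\<Sum>k\<le>N. real (N choose Suc k) *\<^sub>R T (Suc k))"
    by (subst sum.atMost_Suc_shift) simp
  also have "\<dots> + (\<Sum>k\<le>N. real (N choose k) *\<^sub>R T (Suc k)) =
      T 0 + (\<Sum>k\<le>N. real (Suc N choose Suc k) *\<^sub>R T (Suc k))"
    by (simp add: scaleR_add_left sum.distrib)
  also have "\<dots> = (\<Sum>k\<le>Suc N. real (Suc N choose k) *\<^sub>R T k)"
    by (subst sum.atMost_Suc_shift) simp
  finally show ?case by (simp add: T_def)
qed

lemma bump_mean_value_subset:
  assumes "bump_mean_value F U" "V \<subseteq> U"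
  shows "bump_mean_value F V"
  using assms unfolding bump_mean_value_def by (meson continuous_on_subset order_trans)

lemma bump_mean_value_diff:
  fixes F G :: "'a::euclidean_space \<Rightarrow> 'b::euclidean_space"
  assumes "open U" "bump_mean_value F U" "bump_mean_value G U"
  shows "bump_mean_value (\<lambda>x. F x - G x) U"
  unfolding bump_mean_value_def
proof (intro conjI allI impI)
  have cont: "continuous_on U F" "continuous_on U G"
    using assms(2,3) by (auto simp: bump_mean_value_def)
  then show "continuous_on U (\<lambda>x. F x - G x)" by (intro continuous_intros)
  fix x :: 'a and t :: real
  assume t: "0 < t" "cball x t \<subseteq> U"
  then show "integral UNIV (\<lambda>y. (bump t y)\<^sup>2 *\<^sub>R (F (x + y) - G (x + y))) = bump_mass TYPE('a) t *\<^sub>R (F x - G x)"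
    using integral_diff[OF integrable_bump_product(2)[OF assms(1) t cont(1)]
        integrable_bump_product(2)[OF assms(1) t cont(2)]] assms(2,3)
    by (simp add: scaleR_diff_right bump_mean_value_def)
qed

lemma bump_mean_value_const: "bump_mean_value (\<lambda>_. c) U"
  by (simp add: bump_mean_value_def bump_mass_integral)

lemma bump_mean_value_translate:
  fixes F :: "'a::euclidean_space \<Rightarrow> 'b::euclidean_space"
  assumes "bump_mean_value F U"
  shows "bump_mean_value (\<lambda>x. F (x + h)) {x. x + h \<in> U}"
  unfolding bump_mean_value_def
proof (intro conjI allI impI)
  have "continuous_on U F" using assms by (auto simp: bump_mean_value_def)
  then show "continuous_on {x. x + h \<in> U} (\<lambda>x. F (x + h))"
    by (rule continuous_on_compose2) (auto intro!: continuous_intros)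
  fix x :: 'a and t :: real
  assume t: "0 < t" "cball x t \<subseteq> {x. x + h \<in> U}"
  have "cball (x + h) t \<subseteq> U"
  proof
    fix z assume "z \<in> cball (x + h) t"
    then have "z - h \<in> cball x t" by (simp add: dist_norm algebra_simps)
    then show "z \<in> U" using t(2) by fastforce
  qed
  then have "integral UNIV (\<lambda>y. (bump t y)\<^sup>2 *\<^sub>R F (x + h + y)) = bump_mass TYPE('a) t *\<^sub>R F (x + h)"
    using assms t(1) unfolding bump_mean_value_def by blast
  moreover have "x + h + y = x + y + h" for y by simp
  ultimately show "integral UNIV (\<lambda>y. (bump t y)\<^sup>2 *\<^sub>R F (x + y + h)) = bump_mass TYPE('a) t *\<^sub>R F (x + h)"
    by simp
qed

lemma bump_mean_value_forward_diff:
  fixes F :: "'a::euclidean_space \<Rightarrow> 'b::euclidean_space"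
  assumes "open U" "bump_mean_value F U"
  shows "bump_mean_value (forward_diff h F) (U \<inter> {x. x + h \<in> U})" "open (U \<inter> {x. x + h \<in> U})"
proof -
  have "open ((\<lambda>x. x + h) -` U)"
    using assms(1) by (intro open_vimage continuous_intros)
  then show *: "open (U \<inter> {x. x + h \<in> U})"
    using assms(1) by (simp add: vimage_def open_Int)
  show "bump_mean_value (forward_diff h F) (U \<inter> {x. x + h \<in> U})"
    unfolding forward_diff_def[abs_def]
    by (rule bump_mean_value_diff[OF * bump_mean_value_subset[OF bump_mean_value_translate[OF assms(2)]]
          bump_mean_value_subset[OF assms(2)]]) auto
qed

lemma bump_square_lipschitz:
  fixes y h :: "'a::real_inner"
  assumes "norm h \<le> t" "norm y \<le> 2 * t"
  shows "\<bar>(bump t (y - h))\<^sup>2 - (bump t y)\<^sup>2\<bar> \<le> 10 * t ^ 3 * norm h"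
proof -
  have t: "t \<ge> 0" using assms(1) norm_ge_zero[of h] by linarith
  have "\<bar>norm (y - h) - norm y\<bar> \<le> norm h"
    using norm_triangle_ineq3[of "y - h" y] by simp
  moreover have "norm (y - h) + norm y \<le> 5 * t"
    using norm_triangle_ineq4[of y h] assms by linarith
  ultimately have "\<bar>norm (y - h) - norm y\<bar> * (norm (y - h) + norm y) \<le> norm h * (5 * t)"
    by (intro mult_mono) auto
  moreover have "\<bar>(y - h) \<bullet> (y - h) - y \<bullet> y\<bar> = \<bar>norm (y - h) - norm y\<bar> * (norm (y - h) + norm y)"
    by (simp add: dot_square_norm power2_eq_square square_diff_square_factored abs_mult mult.commute)
  moreover have "\<bar>bump t (y - h) - bump t y\<bar> \<le> \<bar>(y - h) \<bullet> (y - h) - y \<bullet> y\<bar>"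
    unfolding bump_def by linarith
  ultimately have 1: "\<bar>bump t (y - h) - bump t y\<bar> \<le> norm h * (5 * t)" by linarith
  have 2: "\<bar>bump t (y - h) + bump t y\<bar> \<le> 2 * t\<^sup>2"
    using bump_le[of t "y - h"] bump_le[of t y] bump_nonneg[of t "y - h"] bump_nonneg[of t y] by linarith
  have "\<bar>(bump t (y - h))\<^sup>2 - (bump t y)\<^sup>2\<bar> = \<bar>bump t (y - h) - bump t y\<bar> * \<bar>bump t (y - h) + bump t y\<bar>"
    by (simp add: power2_eq_square square_diff_square_factored abs_mult mult.commute)
  also have "\<dots> \<le> (norm h * (5 * t)) * (2 * t\<^sup>2)"
    using 1 2 t by (intro mult_mono) auto
  finally show ?thesis by (simp add: power2_eq_square power3_eq_cube mult_ac)
qed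

text \<open>The difference of the weighted means at \<open>x + h\<close> and at \<open>x\<close> is an integral of \<open>F\<close> against the
  difference of two translates of the weight. That difference is at most \<open>10 t\<^sup>3 |h|\<close> on a cube of
  volume \<open>(4 t)\<^sup>n\<close>, while the total weight is \<open>K t\<^sup>n\<^sup>+\<^sup>4\<close>. The constant depends on nothing but the dimension,
  which is essential for the iteration below.\<close>

lemma bump_mean_value_lipschitz:
  obtains C where "C > 0"
    and "\<And>(F :: 'a::euclidean_space \<Rightarrow> 'b::euclidean_space) U x h t M.
      \<lbrakk>open U; bump_mean_value F U; 0 < t; norm h \<le> t; cball x (2 * t) \<subseteq> U;
       \<And>y. y \<in> cball x (2 * t) \<Longrightarrow> norm (F y) \<le> M\<rbrakk> \<Longrightarrow>
      norm (F (x + h) - F x) \<le> C * norm h / t * M"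
proof -
  define n where "n = DIM('a)"
  define K where "K = bump_mass TYPE('a) 1"
  have K: "K > 0" unfolding K_def by (rule bump_mass_pos) simp
  define C where "C = 10 * 4 ^ n / K"
  show thesis
  proof (rule that)
    show "C > 0" using K by (simp add: C_def)
    fix F :: "'a \<Rightarrow> 'b" and U and x h :: 'a and t M :: real
    assume U: "open U" and F: "bump_mean_value F U" and t: "0 < t" and h: "norm h \<le> t"
      and sub: "cball x (2 * t) \<subseteq> U" and M: "\<And>y. y \<in> cball x (2 * t) \<Longrightarrow> norm (F y) \<le> M"
    have cF: "continuous_on U F" using F by (simp add: bump_mean_value_def)
    have s1: "cball x t \<subseteq> U"
      by (rule order_trans[OF subset_cball sub]) (use t in simp)
    have s2: "cball (x + h) t \<subseteq> U"
    proof -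
      have "dist x z \<le> 2 * t" if "dist (x + h) z \<le> t" for z
        using dist_triangle[of x z "x + h"] that h by (simp add: dist_norm)
      then show ?thesis using sub by (auto simp: subset_iff)
    qed
    define G where "G y = (bump t y)\<^sup>2 *\<^sub>R F (x + h + y)" for y
    have G: "continuous_on UNIV G" "G integrable_on UNIV"
      unfolding G_def by (rule integrable_bump_product[OF U t s2 cF])+
    define H where "H y = (bump t y)\<^sup>2 *\<^sub>R F (x + y)" for y
    have H: "continuous_on UNIV H" "H integrable_on UNIV"
      unfolding H_def by (rule integrable_bump_product[OF U t s1 cF])+
    define D where "D y = G (y - h) - H y" for y
    have D: "D y = ((bump t (y - h))\<^sup>2 - (bump t y)\<^sup>2) *\<^sub>R F (x + y)" for y
      by (simp add: D_def G_def H_def scaleR_diff_left)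
    have D0: "D y = 0" if "norm y > 2 * t" for y
    proof -
      have "norm y \<le> norm (y - h) + norm h"
        using norm_triangle_ineq[of "y - h" h] by simp
      then show ?thesis using that h t by (simp add: D bump_eq_0)
    qed
    have Gc: "continuous_on UNIV (\<lambda>y. G (y - h))"
      by (intro continuous_on_compose2[OF G(1)] continuous_intros) auto
    then have Dc: "continuous_on UNIV D"
      unfolding D_def by (intro continuous_intros H)
    have Gi: "(\<lambda>y. G (y - h)) integrable_on UNIV"
      using integrable_add[OF integrable_ball_support(1)[OF Dc D0] H(2)] by (simp add: D_def)
    define a b :: 'a where "a = - (2 * t) *\<^sub>R One" and "b = (2 * t) *\<^sub>R One"
    have "integral UNIV D = integral UNIV (\<lambda>y. G (y - h)) - integral UNIV H"
      unfolding D_def by (rule integral_diff[OF Gi H(2)])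
    also have "integral UNIV (\<lambda>y. G (y - h)) = integral UNIV G"
      using integral_UNIV_translation[OF G(1), of t "- h"] t by (simp add: G_def bump_eq_0)
    also have "integral UNIV G = bump_mass TYPE('a) t *\<^sub>R F (x + h)"
      using F s2 t unfolding G_def bump_mean_value_def by blast
    also have "integral UNIV H = bump_mass TYPE('a) t *\<^sub>R F x"
      using F s1 t unfolding H_def bump_mean_value_def by blast
    also have "bump_mass TYPE('a) t *\<^sub>R F (x + h) - bump_mass TYPE('a) t *\<^sub>R F x =
        (t ^ (n + 4) * K) *\<^sub>R (F (x + h) - F x)"
      using bump_mass_scaling[OF t, where 'a = 'a] by (simp add: K_def n_def scaleR_diff_right)
    finally have "norm ((t ^ (n + 4) * K) *\<^sub>R (F (x + h) - F x)) = norm (integral (cbox a b) D)"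
      using integrable_ball_support(2)[OF Dc D0] by (simp add: a_def b_def)
    also have "\<dots> \<le> (10 * t ^ 3 * norm h * M) * measure lborel (cbox a b)"
    proof (rule has_integral_bound)
      have "M \<ge> 0" using order_trans[OF norm_ge_zero M[of x]] t by simp
      then show "0 \<le> 10 * t ^ 3 * norm h * M" using t by simp
      show "(D has_integral integral (cbox a b) D) (cbox a b)"
        using Dc by (meson continuous_on_subset integrable_continuous integrable_integral top_greatest)
      show "norm (D y) \<le> 10 * t ^ 3 * norm h * M" for y
      proof (cases "norm y \<le> 2 * t")
        case True
        then have "norm (F (x + y)) \<le> M" by (intro M) (simp add: dist_norm)
        then show ?thesis
          unfolding D norm_scaleR real_norm_def
          using bump_square_lipschitz[OF h True] t by (intro mult_mono) auto
      next
        case False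
        then show ?thesis using D0[of y] \<open>M \<ge> 0\<close> t by simp
      qed
    qed
    also have "measure lborel (cbox a b) = (4 * t) ^ n"
    proof -
      have "measure lborel (cbox a b) = (\<Prod>i\<in>(Basis::'a set). 4 * t)"
        unfolding a_def b_def using t by (subst content_cbox) (auto simp: inner_diff_left)
      then show ?thesis by (simp add: n_def)
    qed
    also have "norm ((t ^ (n + 4) * K) *\<^sub>R (F (x + h) - F x)) = t ^ (n + 4) * K * norm (F (x + h) - F x)"
      unfolding norm_scaleR using K t by (subst abs_of_pos) (auto intro!: mult_pos_pos)
    also have "t ^ (n + 4) * K * norm (F (x + h) - F x) = t ^ (n + 3) * (K * t * norm (F (x + h) - F x))"
      by (simp add: power_add power3_eq_cube power4_eq_xxxx)
    also have "10 * t ^ 3 * norm h * M * (4 * t) ^ n = t ^ (n + 3) * (10 * 4 ^ n * norm h * M)"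
      by (simp add: power_add power_mult_distrib)
    finally have "K * t * norm (F (x + h) - F x) \<le> 10 * 4 ^ n * norm h * M"
      using t by (subst (asm) mult_le_cancel_left_pos) auto
    then show "norm (F (x + h) - F x) \<le> C * norm h / t * M"
      using K t by (simp add: C_def field_simps)
  qed
qed

lemma iterated_forward_diff_eq_0:
  assumes "\<And>j. j \<le> k \<Longrightarrow> F (x + real j *\<^sub>R h) = 0"
  shows "(forward_diff h ^^ k) F x = 0"
  using assms
proof (induction k arbitrary: F)
  case 0
  from "0.prems"[of 0] show ?case by simp
next
  case (Suc k)
  have "forward_diff h F (x + real j *\<^sub>R h) = 0" if "j \<le> k" for j
    using Suc.prems[of j] Suc.prems[of "Suc j"] that by (simp add: forward_diff_def algebra_simps)
  then show ?case
    using Suc.IH[of "forward_diff h F"] by (simp add: funpow_swap1)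
qed

text \<open>Each difference costs a factor \<open>C |h| / t\<close> and shrinks the ball by \<open>2 t\<close>. Differences of \<open>F\<close> inherit
  the mean value property, so the Lipschitz bound applies to them again. With \<open>t\<close> proportional to
  \<open>1 / k\<close> this is the discrete form of the Cauchy estimates for \<open>k\<close>-th derivatives.\<close>

lemma bump_mean_value_iterated_diff_bound:
  obtains C where "C > 0"
    and "\<And>(F :: 'a::euclidean_space \<Rightarrow> 'b::euclidean_space) U x h t M k.
      \<lbrakk>open U; bump_mean_value F U; 0 < t; norm h \<le> t; cball x (2 * real k * t) \<subseteq> U;
       \<And>y. y \<in> cball x (2 * real k * t) \<Longrightarrow> norm (F y) \<le> M\<rbrakk> \<Longrightarrow>
      norm ((forward_diff h ^^ k) F x) \<le> (C * norm h / t) ^ k * M"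
proof -
  obtain C where C: "C > 0"
    and lip: "\<And>(F :: 'a \<Rightarrow> 'b) U x h t M.
      \<lbrakk>open U; bump_mean_value F U; 0 < t; norm h \<le> t; cball x (2 * t) \<subseteq> U;
       \<And>y. y \<in> cball x (2 * t) \<Longrightarrow> norm (F y) \<le> M\<rbrakk> \<Longrightarrow>
      norm (F (x + h) - F x) \<le> C * norm h / t * M"
    using bump_mean_value_lipschitz by blast
  have "norm ((forward_diff h ^^ k) F x) \<le> (C * norm h / t) ^ k * M"
    if "open U" "bump_mean_value F U" "0 < t" "norm h \<le> t" "cball x (2 * real k * t) \<subseteq> U"
      "\<And>y. y \<in> cball x (2 * real k * t) \<Longrightarrow> norm (F y) \<le> M"
    for F :: "'a \<Rightarrow> 'b" and U and x h :: 'a and t M :: real and k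
    using that
  proof (induction k arbitrary: F U M)
    case 0
    from "0.prems"(6)[of x] show ?case by simp
  next
    case (Suc k)
    define V where "V = U \<inter> {x. x + h \<in> U}"
    have big: "cball z (2 * t) \<subseteq> cball x (2 * real (Suc k) * t)" if "z \<in> cball x (2 * real k * t)" for z
    proof
      fix w assume "w \<in> cball z (2 * t)"
      then show "w \<in> cball x (2 * real (Suc k) * t)"
        using that dist_triangle[of x w z] by (simp add: algebra_simps)
    qed
    have bound: "norm (forward_diff h F z) \<le> C * norm h / t * M" if "z \<in> cball x (2 * real k * t)" for z
      unfolding forward_diff_def
      by (rule lip[OF Suc.prems(1-4)]) (use big[OF that] Suc.prems(5,6) in blast)+
    have sub: "cball x (2 * real k * t) \<subseteq> V"
    proof
      fix z assume z: "z \<in> cball x (2 * real k * t)"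
      have "z \<in> cball z (2 * t)" "z + h \<in> cball z (2 * t)"
        using Suc.prems(3,4) by (auto simp: dist_norm)
      then show "z \<in> V"
        using big[OF z] Suc.prems(5) unfolding V_def by blast
    qed
    have "norm ((forward_diff h ^^ k) (forward_diff h F) x) \<le> (C * norm h / t) ^ k * (C * norm h / t * M)"
      by (rule Suc.IH[OF _ _ Suc.prems(3,4) sub bound])
        (use bump_mean_value_forward_diff[OF Suc.prems(1,2), of h] in \<open>simp_all add: V_def\<close>)
    then show ?case by (simp add: funpow_swap1 mult_ac)
  qed
  then show thesis using that[of C] C by blast
qed

lemma power_over_fact_le_exp:
  assumes "x \<ge> (0::real)"
  shows "x ^ k / fact k \<le> exp x"
proof -
  have "(\<Sum>n\<in>{k}. x ^ n /\<^sub>R fact n) \<le> (\<Sum>n. x ^ n /\<^sub>R fact n)"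
    using assms by (intro sum_le_suminf summable_exp_generic) auto
  then show ?thesis by (simp add: exp_def field_simps)
qed

lemma sum_half_powers_le: "m \<le> N \<Longrightarrow> (\<Sum>k=m..N. (1/2::real) ^ k) \<le> 2 * (1/2) ^ m - (1/2) ^ N"
  by (induction N rule: dec_induct) (auto simp: sum.atLeast_Suc_atMost atLeastAtMostSuc_conv)

text \<open>From \<open>N choose k \<le> N\<^sup>k / k!\<close> and \<open>k\<^sup>k / k! \<le> e\<^sup>k\<close>.\<close>

lemma binomial_times_power_le:
  assumes "k \<le> N" "N > 0" "c \<ge> 0" "c * exp 1 \<le> 1/2"
  shows "real (N choose k) * (c * real k / real N) ^ k \<le> (1/2) ^ k"
proof -
  have "real (N choose k) * fact k \<le> real N ^ k"
    using binomial_fact_pow[of N k] by (metis of_nat_fact of_nat_le_iff of_nat_mult of_nat_power)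
  then have "real (N choose k) \<le> real N ^ k / fact k"
    by (simp add: pos_le_divide_eq)
  then have "real (N choose k) * (c * real k / real N) ^ k \<le> real N ^ k / fact k * (c * real k / real N) ^ k"
    using assms by (intro mult_right_mono) auto
  also have "\<dots> = c ^ k * (real k ^ k / fact k)"
    using assms by (simp add: power_mult_distrib power_divide)
  also have "\<dots> \<le> c ^ k * exp (real k)"
    using assms power_over_fact_le_exp[of "real k" k] by (intro mult_left_mono) auto
  also have "\<dots> = (c * exp 1) ^ k"
    by (simp add: power_mult_distrib flip: exp_of_nat_mult)
  also have "\<dots> \<le> (1/2) ^ k"
    using assms by (intro power_mono) auto
  finally show ?thesis .
qed

text \<open>Expand \<open>F(x + v)\<close> by Newton's formula with step \<open>h = v / N\<close>. The differences of order \<open>k < m\<close> involve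
  values of \<open>F\<close> within distance \<open>\<epsilon>\<close> of \<open>x\<close> only, hence vanish, if \<open>N\<close> is a suitable multiple of \<open>m\<close>; for
  \<open>k \<ge> m\<close> the summand is at most \<open>2\<^sup>-\<^sup>k M\<close>, provided \<open>|v| < \<delta> r\<close>. As \<open>m\<close> grows, the sum tends to \<open>0\<close>. It is
  important that \<open>\<delta>\<close> depends neither on \<open>F\<close> nor on \<open>\<epsilon>\<close>: the zero set then grows by a definite amount.\<close>

lemma bump_mean_value_local_unique_continuation:
  obtains \<delta> where "0 < \<delta>" "\<delta> \<le> 1/2"
    and "\<And>(F :: 'a::euclidean_space \<Rightarrow> 'b::euclidean_space) U x y r \<epsilon>.
      \<lbrakk>open U; bump_mean_value F U; 0 < r; cball x r \<subseteq> U; 0 < \<epsilon>;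
       \<And>y. y \<in> ball x \<epsilon> \<Longrightarrow> F y = 0; y \<in> ball x (\<delta> * r)\<rbrakk> \<Longrightarrow> F y = 0"
proof -
  obtain C where C: "C > 0"
    and iter: "\<And>(F :: 'a \<Rightarrow> 'b) U x h t M k.
      \<lbrakk>open U; bump_mean_value F U; 0 < t; norm h \<le> t; cball x (2 * real k * t) \<subseteq> U;
       \<And>y. y \<in> cball x (2 * real k * t) \<Longrightarrow> norm (F y) \<le> M\<rbrakk> \<Longrightarrow>
      norm ((forward_diff h ^^ k) F x) \<le> (C * norm h / t) ^ k * M"
    using bump_mean_value_iterated_diff_bound by blast
  \<comment> \<open>The second bound makes the summands geometric with ratio \<open>1/2\<close>; the first keeps every step
    admissible in the estimate for iterated differences.\<close>
  define \<delta> where "\<delta> = min (1/2) (1 / (4 * exp 1 * C))"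
  have \<delta>: "0 < \<delta>" "\<delta> \<le> 1/2" using C by (auto simp: \<delta>_def)
  have small: "2 * C * \<delta> * exp 1 \<le> 1/2"
  proof -
    have "2 * C * \<delta> * exp 1 \<le> 2 * C * (1 / (4 * exp 1 * C)) * exp 1"
      using C by (intro mult_right_mono mult_left_mono) (auto simp: \<delta>_def)
    then show ?thesis using C by simp
  qed
  show thesis
  proof (rule that[OF \<delta>])
    fix F :: "'a \<Rightarrow> 'b" and U and x y :: 'a and r \<epsilon> :: real
    assume U: "open U" and F: "bump_mean_value F U" and r: "0 < r" and sub: "cball x r \<subseteq> U"
      and \<epsilon>: "0 < \<epsilon>" and zero: "\<And>y. y \<in> ball x \<epsilon> \<Longrightarrow> F y = 0" and y: "y \<in> ball x (\<delta> * r)"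
    define v where "v = y - x"
    have v: "norm v < \<delta> * r" using y by (simp add: v_def dist_norm norm_minus_commute)
    have "compact (F ` cball x r)"
      using F sub unfolding bump_mean_value_def
      by (meson compact_cball compact_continuous_image continuous_on_subset)
    then obtain M where M: "\<And>z. z \<in> cball x r \<Longrightarrow> norm (F z) \<le> M"
      by (metis bounded_iff compact_imp_bounded imageI)
    have M0: "M \<ge> 0" using order_trans[OF norm_ge_zero M[of x]] r by simp
    obtain L :: nat where L: "norm v / \<epsilon> < real L" using reals_Archimedean2 by blast
    have L0: "L > 0"
      using L \<epsilon> by (metis divide_nonneg_pos gr0I norm_ge_zero not_less of_nat_0)
    have bound: "norm (F y) \<le> 2 * M * (1/2) ^ m" if m: "m > 0" for m
    proof -
      \<comment> \<open>The choice of \<open>L\<close> gives \<open>m |h| < \<epsilon>\<close>.\<close>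
      define N where "N = m * L"
      have N: "N > 0" "m \<le> N" using m L0 by (auto simp: N_def)
      define h where "h = (1 / real N) *\<^sub>R v"
      have nh: "norm h = norm v / real N" by (simp add: h_def)
      have summand: "norm (real (N choose k) *\<^sub>R (forward_diff h ^^ k) F x) \<le>
          (if k < m then 0 else (1/2) ^ k * M)" if k: "k \<le> N" for k
      proof (cases "k < m")
        case True
        have "F (x + real j *\<^sub>R h) = 0" if "j \<le> k" for j
        proof (rule zero)
          have "norm v < \<epsilon> * real L" using L \<epsilon> by (simp add: divide_less_eq mult.commute)
          moreover have "real j * norm v \<le> real m * norm v"
            using that True by (intro mult_right_mono) auto
          ultimately have "real j * norm v < real m * (\<epsilon> * real L)"
            using m by (meson le_less_trans mult_strict_left_mono of_nat_0_less_iff)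
          then have "norm (real j *\<^sub>R h) < \<epsilon>"
            using N by (simp add: nh N_def divide_less_eq mult_ac)
          then show "x + real j *\<^sub>R h \<in> ball x \<epsilon>" by (simp add: dist_norm)
        qed
        then have "(forward_diff h ^^ k) F x = 0" by (rule iterated_forward_diff_eq_0)
        then show ?thesis using True by simp
      next
        case False
        then have k0: "k > 0" using m by simp
        \<comment> \<open>The \<open>k\<close> differences together use up the ball of radius \<open>2 k t = r\<close>.\<close>
        define t where "t = r / (2 * real k)"
        have t: "t > 0" "2 * real k * t = r" using r k0 by (auto simp: t_def)
        have "norm v / real N \<le> (r / 2) / real k"
        proof (rule frac_le)
          have "\<delta> * r \<le> (1/2) * r" using \<delta>(2) r by (intro mult_right_mono) auto
          then show "norm v \<le> r / 2" using v by simp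
        qed (use k k0 r in auto)
        then have ht: "norm h \<le> t" by (simp add: nh t_def)
        have "C * norm h / t = 2 * C * real k * norm v / (r * real N)"
          by (simp add: nh t_def mult_ac)
        also have "\<dots> \<le> 2 * C * real k * (\<delta> * r) / (r * real N)"
          using C v r N by (intro divide_right_mono mult_left_mono) auto
        also have "\<dots> = 2 * C * \<delta> * real k / real N"
          using r by simp
        finally have q: "C * norm h / t \<le> 2 * C * \<delta> * real k / real N" .
        have "norm ((forward_diff h ^^ k) F x) \<le> (C * norm h / t) ^ k * M"
          using iter[OF U F t(1) ht, of x k M] t(2) sub M by auto
        also have "\<dots> \<le> (2 * C * \<delta> * real k / real N) ^ k * M"
          using q C t(1) M0 by (intro mult_right_mono power_mono) auto
        finally have "real (N choose k) * norm ((forward_diff h ^^ k) F x) \<le>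
            real (N choose k) * (2 * C * \<delta> * real k / real N) ^ k * M"
          by (simp add: mult_left_mono mult.assoc)
        also have "\<dots> \<le> (1/2) ^ k * M"
          using binomial_times_power_le[OF k N(1) _ small] C \<delta>(1) M0 by (intro mult_right_mono) auto
        finally show ?thesis using False by simp
      qed
      have "y = x + real N *\<^sub>R h" using N by (simp add: h_def v_def)
      then have "norm (F y) = norm (\<Sum>k\<le>N. real (N choose k) *\<^sub>R (forward_diff h ^^ k) F x)"
        using newton_forward[of F x N h] by simp
      also have "\<dots> \<le> (\<Sum>k\<le>N. if k < m then 0 else (1/2) ^ k * M)"
        by (rule sum_norm_le) (use summand in auto)
      also have "\<dots> = (\<Sum>k=m..N. (1/2) ^ k * M)"
        by (intro sum.mono_neutral_cong_right) auto
      also have "\<dots> = (\<Sum>k=m..N. (1/2) ^ k) * M"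
        by (simp add: sum_distrib_right)
      also have "\<dots> \<le> (2 * (1/2) ^ m) * M"
      proof (rule mult_right_mono[OF _ M0])
        have "(0::real) \<le> (1/2) ^ N" by simp
        then show "(\<Sum>k=m..N. (1/2::real) ^ k) \<le> 2 * (1/2) ^ m"
          using sum_half_powers_le[OF N(2)] by linarith
      qed
      finally show ?thesis by (simp add: mult_ac)
    qed
    have "(\<lambda>m. 2 * M * (1/2) ^ m) \<longlonglongrightarrow> 2 * M * 0"
      by (intro tendsto_intros LIMSEQ_realpow_zero) auto
    then have "norm (F y) \<le> 2 * M * 0"
      by (rule LIMSEQ_le_const) (use bound in \<open>auto intro!: exI[of _ 1]\<close>)
    then show "F y = 0" by simp
  qed
qed

text \<open>The interior of the zero set is relatively closed: near a limit point of it, the local statement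
  applies on balls of a fixed radius, and \<open>\<delta>\<close> being uniform, the zeros reach the limit point.\<close>

lemma bump_mean_value_unique_continuation:
  fixes F :: "'a::euclidean_space \<Rightarrow> 'b::euclidean_space"
  assumes U: "open U" "connected U" and F: "bump_mean_value F U"
    and W: "open W" "W \<subseteq> U" "W \<noteq> {}" and zero: "\<And>x. x \<in> W \<Longrightarrow> F x = 0"
    and "x \<in> U"
  shows "F x = 0"
proof -
  obtain \<delta> where \<delta>: "0 < \<delta>" "\<delta> \<le> 1/2"
    and near: "\<And>(F :: 'a \<Rightarrow> 'b) U x y r \<epsilon>.
      \<lbrakk>open U; bump_mean_value F U; 0 < r; cball x r \<subseteq> U; 0 < \<epsilon>;
       \<And>y. y \<in> ball x \<epsilon> \<Longrightarrow> F y = 0; y \<in> ball x (\<delta> * r)\<rbrakk> \<Longrightarrow> F y = 0"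
    using bump_mean_value_local_unique_continuation by blast
  define Z where "Z = interior {x. F x = 0}"
  have "open Z" by (simp add: Z_def)
  have "open (U - Z)"
    unfolding open_contains_ball
  proof
    fix z assume z: "z \<in> U - Z"
    then obtain R where R: "R > 0" "cball z R \<subseteq> U"
      using open_contains_cball_eq[OF U(1)] by blast
    define r where "r = R / 2"
    have R2: "R = 2 * r" by (simp add: r_def)
    have r: "r > 0" "\<delta> * r \<le> r"
      using R(1) \<delta> by (auto simp: r_def mult_left_le_one_le)
    have "w \<in> U - Z" if w: "w \<in> ball z (\<delta> * r)" for w
    proof -
      have dist: "dist z w < \<delta> * r" using w by simp
      have subw: "cball w r \<subseteq> U"
      proof
        fix u assume "u \<in> cball w r"
        then have "dist z u \<le> R"
          using dist_triangle[of z u w] dist r(2) R2 by simp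
        then show "u \<in> U" using R(2) by auto
      qed
      moreover have "w \<in> cball w r" using r(1) by simp
      ultimately have "w \<in> U" by blast
      moreover have "w \<notin> Z"
      proof
        assume "w \<in> Z"
        then obtain \<epsilon> where "\<epsilon> > 0" "ball w \<epsilon> \<subseteq> {x. F x = 0}"
          unfolding Z_def mem_interior by blast
        then have "ball w (\<delta> * r) \<subseteq> {x. F x = 0}"
          using near[OF U(1) F r(1) subw, of \<epsilon>] by blast
        moreover have "z \<in> ball w (\<delta> * r)" using dist by (simp add: dist_commute)
        ultimately have "z \<in> Z" unfolding Z_def by (meson interiorI open_ball)
        then show False using z by simp
      qed
      ultimately show ?thesis by blast
    qed
    then show "\<exists>e>0. ball z e \<subseteq> U - Z"
      using r \<delta> by (intro exI[of _ "\<delta> * r"]) auto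
  qed
  have "W \<subseteq> Z"
    unfolding Z_def using zero W(1) by (intro interior_maximal) auto
  then have "Z \<inter> U \<noteq> {}" using W by blast
  then have "(U - Z) \<inter> U = {}"
    using connectedD[OF U(2) \<open>open Z\<close> \<open>open (U - Z)\<close>] by blast
  then have "x \<in> Z" using \<open>x \<in> U\<close> by blast
  then show ?thesis unfolding Z_def using interior_subset by blast
qed

section \<open>Octonion multiplication\<close>

lemma sum_1_7: "(\<Sum>k=1..7. g k) = g 1 + g 2 + g 3 + g 4 + g 5 + g 6 + g (7::nat)"
  by (simp add: eval_nat_numeral add.assoc)

lemma oct_table_values:
  shows
    "oct_table 1 1 = - oct_e 0" "oct_table 1 2 = oct_e 3" "oct_table 1 3 = - oct_e 2" "oct_table 1 4 = oct_e 5"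
    "oct_table 1 5 = - oct_e 4" "oct_table 1 6 = - oct_e 7" "oct_table 1 7 = oct_e 6"
    "oct_table 2 1 = - oct_e 3" "oct_table 2 2 = - oct_e 0" "oct_table 2 3 = oct_e 1" "oct_table 2 4 = oct_e 6"
    "oct_table 2 5 = oct_e 7" "oct_table 2 6 = - oct_e 4" "oct_table 2 7 = - oct_e 5"
    "oct_table 3 1 = oct_e 2" "oct_table 3 2 = - oct_e 1" "oct_table 3 3 = - oct_e 0" "oct_table 3 4 = oct_e 7"
    "oct_table 3 5 = - oct_e 6" "oct_table 3 6 = oct_e 5" "oct_table 3 7 = - oct_e 4"
    "oct_table 4 1 = - oct_e 5" "oct_table 4 2 = - oct_e 6" "oct_table 4 3 = - oct_e 7" "oct_table 4 4 = - oct_e 0"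
    "oct_table 4 5 = oct_e 1" "oct_table 4 6 = oct_e 2" "oct_table 4 7 = oct_e 3"
    "oct_table 5 1 = oct_e 4" "oct_table 5 2 = - oct_e 7" "oct_table 5 3 = oct_e 6" "oct_table 5 4 = - oct_e 1"
    "oct_table 5 5 = - oct_e 0" "oct_table 5 6 = - oct_e 3" "oct_table 5 7 = oct_e 2"
    "oct_table 6 1 = oct_e 7" "oct_table 6 2 = oct_e 4" "oct_table 6 3 = - oct_e 5" "oct_table 6 4 = - oct_e 2"
    "oct_table 6 5 = oct_e 3" "oct_table 6 6 = - oct_e 0" "oct_table 6 7 = - oct_e 1"
    "oct_table 7 1 = - oct_e 6" "oct_table 7 2 = oct_e 5" "oct_table 7 3 = oct_e 4" "oct_table 7 4 = - oct_e 3"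
    "oct_table 7 5 = - oct_e 2" "oct_table 7 6 = oct_e 1" "oct_table 7 7 = - oct_e 0"
  unfolding oct_table_def oct_eps_def oct_triples_def
  by (simp_all add: sum_1_7 del: One_nat_def)

lemma oct_mult_linear_right: "linear ((\<otimes>) x)"
  by (rule linearI)
    (simp_all add: oct_mult_def inner_add_left algebra_simps sum.distrib scaleR_sum_right)

lemma oct_mult_add_right: "x \<otimes> (y + z) = x \<otimes> y + x \<otimes> z"
  and oct_mult_scaleR_right: "x \<otimes> (r *\<^sub>R y) = r *\<^sub>R (x \<otimes> y)"
  and oct_mult_minus_right: "x \<otimes> (- y) = - (x \<otimes> y)"
  and oct_mult_0_right: "x \<otimes> 0 = 0"
  and oct_mult_sum_right: "x \<otimes> (\<Sum>i\<in>A. g i) = (\<Sum>i\<in>A. x \<otimes> g i)"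
  using oct_mult_linear_right[of x]
  by (simp_all add: linear_add linear_scale linear_neg linear_0 linear_sum)

lemma oct_mult_linear_left: "linear (\<lambda>x. x \<otimes> y)"
  by (rule linearI)
    (simp_all add: oct_mult_def inner_add_left algebra_simps sum.distrib scaleR_sum_right)

lemma oct_mult_scaleR_left: "(r *\<^sub>R x) \<otimes> y = r *\<^sub>R (x \<otimes> y)"
  by (rule linear_scale[OF oct_mult_linear_left])

lemma oct_mult_sum_left: "(\<Sum>i\<in>A. g i) \<otimes> y = (\<Sum>i\<in>A. g i \<otimes> y)"
  by (rule linear_sum[OF oct_mult_linear_left])

lemma Basis_octonion: "(Basis :: octonion set) = oct_e ` {..7}"
proof -
  have "\<exists>k\<le>7. i = of_nat k" for i :: 8
  proof (cases i)
    case (of_int z)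
    then show ?thesis by (intro exI[of _ "nat z"]) auto
  qed
  then have range: "(UNIV :: 8 set) = of_nat ` {..7}" by auto
  have "(Basis :: octonion set) = (\<lambda>i. axis i 1) ` UNIV"
    by (auto simp: Basis_vec_def)
  then show ?thesis
    unfolding range image_image oct_e_def .
qed

lemma inj_on_oct_e: "inj_on oct_e {..7}"
proof (rule inj_onI)
  fix i j assume "i \<in> {..7::nat}" "j \<in> {..7::nat}" "oct_e i = oct_e j"
  then show "i = j" using oct_e_inner[of i j] oct_e_inner[of i i] by (auto split: if_splits)
qed

lemma sum_Basis_octonion: "(\<Sum>b\<in>Basis. g (b::octonion)) = (\<Sum>i\<le>7. g (oct_e i))"
  unfolding Basis_octonion by (simp add: sum.reindex[OF inj_on_oct_e] o_def)

lemma octonion_representation: "(\<Sum>i\<le>7. (z \<bullet> oct_e i) *\<^sub>R oct_e i) = z"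
  using euclidean_representation[of z] sum_Basis_octonion[of "\<lambda>b. (z \<bullet> b) *\<^sub>R b"] by simp

text \<open>The octonion conjugate of \<open>e\<^sub>i\<close> is \<open>conj_sign i\<close> times \<open>e\<^sub>i\<close>.\<close>

definition conj_sign :: "nat \<Rightarrow> real" where
  "conj_sign i = (if i = 0 then 1 else - 1)"

lemma le_7_cases:
  assumes "i \<le> (7::nat)"
  obtains "i = 0" | "i = 1" | "i = 2" | "i = 3" | "i = 4" | "i = 5" | "i = 6" | "i = 7"
  using assms by linarith

lemma oct_clifford_basis:
  assumes "i \<le> 7" "j \<le> 7" "k \<le> 7"
  shows "conj_sign i *\<^sub>R (oct_e i \<otimes> (oct_e j \<otimes> oct_e k)) + conj_sign j *\<^sub>R (oct_e j \<otimes> (oct_e i \<otimes> oct_e k)) =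
     (if i = j then 2 else 0) *\<^sub>R oct_e k"
proof -
  have zero: "oct_table 0 j = oct_e j" "oct_table j 0 = oct_e j" for j
    by (auto simp: oct_table_def)
  show ?thesis
    by (rule le_7_cases[OF assms(1)]; rule le_7_cases[OF assms(2)]; rule le_7_cases[OF assms(3)])
      (simp_all add: oct_mult_basis oct_table_values zero conj_sign_def oct_mult_minus_right scaleR_2 del: One_nat_def)
qed

text \<open>Left multiplications by the basis elements satisfy the relations of a Clifford algebra although the
  product is not associative: this is how alternativity enters. By linearity it suffices to check them
  on the multiplication table.\<close>

lemma oct_clifford:
  assumes "i \<le> 7" "j \<le> 7"
  shows "conj_sign i *\<^sub>R (oct_e i \<otimes> (oct_e j \<otimes> z)) + conj_sign j *\<^sub>R (oct_e j \<otimes> (oct_e i \<otimes> z)) =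
     (if i = j then 2 else 0) *\<^sub>R z"
proof -
  define T where "T z = conj_sign i *\<^sub>R (oct_e i \<otimes> (oct_e j \<otimes> z)) + conj_sign j *\<^sub>R (oct_e j \<otimes> (oct_e i \<otimes> z))" for z
  have "linear T"
    by (rule linearI) (simp_all add: T_def oct_mult_add_right oct_mult_scaleR_right algebra_simps)
  then have "T z = (\<Sum>k\<le>7. (z \<bullet> oct_e k) *\<^sub>R T (oct_e k))"
    by (metis (no_types, lifting) linear_scale linear_sum octonion_representation sum.cong)
  also have "\<dots> = (\<Sum>k\<le>7. (z \<bullet> oct_e k) *\<^sub>R ((if i = j then 2 else 0) *\<^sub>R oct_e k))"
    using oct_clifford_basis[OF assms] by (intro sum.cong) (auto simp: T_def)
  also have "\<dots> = (if i = j then 2 else 0) *\<^sub>R (\<Sum>k\<le>7. (z \<bullet> oct_e k) *\<^sub>R oct_e k)"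
    by (simp add: scaleR_sum_right mult.commute)
  finally show ?thesis
    unfolding octonion_representation T_def .
qed

section \<open>Monogenic functions have the mean value property\<close>

text \<open>Let \<open>J\<^sub>i\<^sub>j\<close> be the integral of \<open>F\<close> against the \<open>j\<close>-th partial derivative of \<open>y\<^sub>i u\<^sub>t\<^sup>2\<close>; it is symmetric
  in \<open>i\<close> and \<open>j\<close>. Moving the derivative to \<open>F\<close>, the equation gives \<open>\<Sum>\<^sub>j e\<^sub>j J\<^sub>i\<^sub>j = 0\<close> for every \<open>i\<close>. Applying
  \<open>c\<^sub>i e\<^sub>i\<close> from the left, summing over \<open>i\<close> and symmetrizing, only the diagonal survives, and
  \<open>\<Sum>\<^sub>i J\<^sub>i\<^sub>i = 0\<close> is weak harmonicity.\<close>

theorem octonion_monogenic_bump_mean_value: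
  fixes F :: "octonion \<Rightarrow> octonion"
  assumes "open U" and F: "has_partials F F' U"
    and dirac: "\<And>x. x \<in> U \<Longrightarrow> (\<Sum>i\<le>7. oct_e i \<otimes> F' (oct_e i) x) = 0"
  shows "bump_mean_value F U"
proof (rule bump_mean_valueI[OF \<open>open U\<close>])
  show cF: "continuous_on U F" using has_partials_imp_continuous_on[OF assms(1) F] .
  fix x :: octonion and t :: real
  assume t: "0 < t" "cball x t \<subseteq> U"
  define J where "J a b = integral UNIV (\<lambda>y. ((a \<bullet> b) * (bump t y)\<^sup>2 - 4 * (y \<bullet> b) * (y \<bullet> a) * bump t y) *\<^sub>R F (x + y))"
    for a b :: octonion
  have J_sym: "J a b = J b a" for a b
    by (simp add: J_def inner_commute[of a b] mult_ac)
  have in_Basis: "oct_e i \<in> Basis" if "i \<le> 7" for i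
    using that by (auto simp: Basis_octonion)
  have row: "(\<Sum>j\<le>7. oct_e j \<otimes> J (oct_e j) (oct_e i)) = 0" if i: "i \<le> 7" for i
  proof -
    define \<phi> where "\<phi> y = (y \<bullet> oct_e i) * (bump t y)\<^sup>2" for y
    have c\<phi>: "continuous_on UNIV \<phi>" unfolding \<phi>_def by (intro continuous_intros)
    have int: "(\<lambda>y. \<phi> y *\<^sub>R F' (oct_e j) (x + y)) integrable_on UNIV" if "j \<le> 7" for j
    proof (rule integrable_ball_support(1)[where R = t])
      have "continuous_on U (F' (oct_e j))"
        using F in_Basis[OF that] by (auto simp: has_partials_def)
      then show "continuous_on UNIV (\<lambda>y. \<phi> y *\<^sub>R F' (oct_e j) (x + y))"
        using t by (intro continuous_cutoff[OF assms(1) t(2) _ c\<phi>]) (auto simp: \<phi>_def bump_eq_0)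
    qed (use t in \<open>auto simp: \<phi>_def bump_eq_0\<close>)
    have lin: "bounded_linear ((\<otimes>) (oct_e j))" for j
      using oct_mult_linear_right linear_conv_bounded_linear by blast
    have "(\<Sum>j\<le>7. oct_e j \<otimes> J (oct_e j) (oct_e i)) =
        (\<Sum>j\<le>7. - integral UNIV (\<lambda>y. oct_e j \<otimes> (\<phi> y *\<^sub>R F' (oct_e j) (x + y))))"
    proof (intro sum.cong refl)
      fix j assume "j \<in> {..7::nat}"
      then have j: "j \<le> 7" by simp
      have "J (oct_e j) (oct_e i) = - integral UNIV (\<lambda>y. \<phi> y *\<^sub>R F' (oct_e j) (x + y))"
        unfolding J_def \<phi>_def
        by (rule bump_integration_by_parts[OF assms(1) t F in_Basis[OF i] in_Basis[OF j]])
      then show "oct_e j \<otimes> J (oct_e j) (oct_e i) = - integral UNIV (\<lambda>y. oct_e j \<otimes> (\<phi> y *\<^sub>R F' (oct_e j) (x + y)))"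
        using integral_linear[OF int[OF j] lin[of j]] by (simp add: oct_mult_minus_right o_def)
    qed
    also have "\<dots> = - integral UNIV (\<lambda>y. \<Sum>j\<le>7. oct_e j \<otimes> (\<phi> y *\<^sub>R F' (oct_e j) (x + y)))"
      unfolding sum_negf
      by (subst integral_sum) (use integrable_linear[OF int lin] in \<open>auto simp: o_def\<close>)
    also have "(\<lambda>y. \<Sum>j\<le>7. oct_e j \<otimes> (\<phi> y *\<^sub>R F' (oct_e j) (x + y))) = (\<lambda>y. 0)"
    proof
      fix y
      have *: "(\<Sum>j\<le>7. oct_e j \<otimes> (\<phi> y *\<^sub>R F' (oct_e j) (x + y))) =
          \<phi> y *\<^sub>R (\<Sum>j\<le>7. oct_e j \<otimes> F' (oct_e j) (x + y))"
        by (simp add: oct_mult_scaleR_right scaleR_sum_right)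
      show "(\<Sum>j\<le>7. oct_e j \<otimes> (\<phi> y *\<^sub>R F' (oct_e j) (x + y))) = 0"
      proof (cases "norm y \<le> t")
        case True
        then have "x + y \<in> U" using t(2) by (auto simp: dist_norm)
        then show ?thesis unfolding * by (simp add: dirac)
      next
        case False
        then show ?thesis unfolding * using t by (simp add: \<phi>_def bump_eq_0)
      qed
    qed
    finally show ?thesis by simp
  qed
  define A where "A i j = conj_sign i *\<^sub>R (oct_e i \<otimes> (oct_e j \<otimes> J (oct_e j) (oct_e i)))" for i j
  have "(\<Sum>i\<le>7. \<Sum>j\<le>7. A i j) =
      (\<Sum>i\<le>7. conj_sign i *\<^sub>R (oct_e i \<otimes> (\<Sum>j\<le>7. oct_e j \<otimes> J (oct_e j) (oct_e i))))"
    by (simp add: A_def oct_mult_sum_right scaleR_sum_right)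
  also have "\<dots> = 0" using row by (simp add: oct_mult_0_right)
  finally have A0: "(\<Sum>i\<le>7. \<Sum>j\<le>7. A i j) = 0" .
  moreover have "(\<Sum>i\<le>7. \<Sum>j\<le>7. A i j) = (\<Sum>i\<le>7. \<Sum>j\<le>7. A j i)"
    by (rule sum.swap)
  ultimately have "0 = (\<Sum>i\<le>7. \<Sum>j\<le>7. A i j + A j i)"
    by (simp add: sum.distrib)
  also have "\<dots> = (\<Sum>i\<le>7. \<Sum>j\<le>7. if i = j then 2 *\<^sub>R J (oct_e i) (oct_e i) else 0)"
  proof (intro sum.cong refl)
    fix i j assume "i \<in> {..7::nat}" "j \<in> {..7::nat}"
    then show "A i j + A j i = (if i = j then 2 *\<^sub>R J (oct_e i) (oct_e i) else 0)"
      using oct_clifford[of i j "J (oct_e j) (oct_e i)"] J_sym[of "oct_e i" "oct_e j"]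
      by (auto simp: A_def)
  qed
  also have "\<dots> = 2 *\<^sub>R (\<Sum>i\<le>7. J (oct_e i) (oct_e i))"
    by (simp add: scaleR_sum_right)
  finally have "(\<Sum>i\<le>7. J (oct_e i) (oct_e i)) = 0" by simp
  then show "(\<Sum>i\<in>Basis. integral UNIV (\<lambda>y. ((i \<bullet> i) * (bump t y)\<^sup>2 - 4 * (y \<bullet> i) * (y \<bullet> i) * bump t y) *\<^sub>R F (x + y))) = 0"
    unfolding sum_Basis_octonion J_def .
qed

text \<open>The Clifford relations yield \<open>a\<^sup>* (a z) = |a|\<^sup>2 z\<close> for the conjugate \<open>a\<^sup>*\<close> of \<open>a\<close>, so left multiplication by
  a nonzero octonion is injective.\<close>

lemma oct_mult_left_cancel_0:
  assumes "a \<otimes> z = 0" "a \<noteq> 0"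
  shows "z = 0"
proof -
  define \<alpha> where "\<alpha> i = a \<bullet> oct_e i" for i
  have a: "a = (\<Sum>i\<le>7. \<alpha> i *\<^sub>R oct_e i)"
    by (simp add: \<alpha>_def octonion_representation)
  have mult_a: "a \<otimes> w = (\<Sum>j\<le>7. \<alpha> j *\<^sub>R (oct_e j \<otimes> w))" for w
    by (subst a) (simp add: oct_mult_sum_left oct_mult_scaleR_left)
  define A where "A i j = (\<alpha> i * \<alpha> j) *\<^sub>R conj_sign i *\<^sub>R (oct_e i \<otimes> (oct_e j \<otimes> z))" for i j
  have "(\<Sum>i\<le>7. \<Sum>j\<le>7. A i j) = (\<Sum>i\<le>7. \<alpha> i *\<^sub>R conj_sign i *\<^sub>R (oct_e i \<otimes> (a \<otimes> z)))"
    unfolding mult_a by (simp add: A_def oct_mult_sum_right oct_mult_scaleR_right scaleR_sum_right mult_ac)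
  also have "\<dots> = 0" using assms by (simp add: oct_mult_0_right)
  finally have "(\<Sum>i\<le>7. \<Sum>j\<le>7. A i j) = 0" .
  moreover have "(\<Sum>i\<le>7. \<Sum>j\<le>7. A i j) = (\<Sum>i\<le>7. \<Sum>j\<le>7. A j i)"
    by (rule sum.swap)
  ultimately have "0 = (\<Sum>i\<le>7. \<Sum>j\<le>7. A i j + A j i)"
    by (simp add: sum.distrib)
  also have "\<dots> = (\<Sum>i\<le>7. \<Sum>j\<le>7. if i = j then (2 * (\<alpha> i)\<^sup>2) *\<^sub>R z else 0)"
  proof (intro sum.cong refl)
    fix i j assume "i \<in> {..7::nat}" "j \<in> {..7::nat}"
    then have "(\<alpha> i * \<alpha> j) *\<^sub>R (conj_sign i *\<^sub>R (oct_e i \<otimes> (oct_e j \<otimes> z)) + conj_sign j *\<^sub>R (oct_e j \<otimes> (oct_e i \<otimes> z))) =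
        (\<alpha> i * \<alpha> j) *\<^sub>R ((if i = j then 2 else 0) *\<^sub>R z)"
      using oct_clifford[of i j z] by simp
    then show "A i j + A j i = (if i = j then (2 * (\<alpha> i)\<^sup>2) *\<^sub>R z else 0)"
      by (auto simp: A_def scaleR_add_right power2_eq_square mult_ac split: if_splits)
  qed
  also have "\<dots> = (2 * (\<Sum>i\<le>7. (\<alpha> i)\<^sup>2)) *\<^sub>R z"
    by (simp add: scaleR_sum_left sum_distrib_left)
  also have "(\<Sum>i\<le>7. (\<alpha> i)\<^sup>2) = a \<bullet> a"
    by (simp add: \<alpha>_def euclidean_inner[of a a] sum_Basis_octonion power2_eq_square)
  finally show ?thesis using assms(2) by simp
qed

section \<open>From slices to open sets in the octonions\<close>

lemma slice_sphere_inner: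
  assumes "\<omega> \<in> slice_sphere p"
  shows "i \<le> p \<Longrightarrow> i \<le> 7 \<Longrightarrow> \<omega> \<bullet> oct_e i = 0" and "\<omega> \<bullet> \<omega> = 1"
proof -
  obtain x :: "nat \<Rightarrow> real" where x: "\<omega> = (\<Sum>i=p+1..7. x i *\<^sub>R oct_e i)" "(\<Sum>i=p+1..7. (x i)\<^sup>2) = 1"
    using assms unfolding slice_sphere_def by blast
  have comp: "\<omega> \<bullet> oct_e j = (if j \<in> {p+1..7} then x j else 0)" if "j \<le> 7" for j
  proof -
    have "\<omega> \<bullet> oct_e j = (\<Sum>i=p+1..7. if j = i then x i else 0)"
      unfolding x(1) inner_sum_left
      using that by (intro sum.cong) (auto simp: oct_e_inner)
    then show ?thesis by simp
  qed
  then show "i \<le> p \<Longrightarrow> i \<le> 7 \<Longrightarrow> \<omega> \<bullet> oct_e i = 0" by simp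
  have "\<omega> \<bullet> \<omega> = (\<Sum>i=p+1..7. x i * (oct_e i \<bullet> \<omega>))"
    by (subst (1) x(1)) (simp add: inner_sum_left)
  also have "\<dots> = (\<Sum>i=p+1..7. (x i)\<^sup>2)"
    by (intro sum.cong refl) (use comp in \<open>simp add: inner_commute power2_eq_square\<close>)
  finally show "\<omega> \<bullet> \<omega> = 1" using x(2) by simp
qed

lemma slice_sphere_decomposition:
  assumes "p \<le> 6"
  obtains x r \<omega> where "\<omega> \<in> slice_sphere p" "x \<in> paravectors p" "r \<ge> 0" "a = x + r *\<^sub>R \<omega>"
proof -
  define x where "x = (\<Sum>i\<le>p. (a \<bullet> oct_e i) *\<^sub>R oct_e i)"
  define w where "w = (\<Sum>i=p+1..7. (a \<bullet> oct_e i) *\<^sub>R oct_e i)"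
  have "{..7} = {..p} \<union> {p+1..7}" using assms by auto
  then have "(\<Sum>i\<le>7. (a \<bullet> oct_e i) *\<^sub>R oct_e i) = x + w"
    unfolding x_def w_def by (simp only:) (intro sum.union_disjoint, auto)
  then have a: "a = x + w" by (simp add: octonion_representation)
  have x: "x \<in> paravectors p"
    unfolding x_def paravectors_def by (intro span_sum span_scale span_base) auto
  define s where "s = (\<Sum>i=p+1..7. (a \<bullet> oct_e i)\<^sup>2)"
  have "s \<ge> 0" unfolding s_def by (intro sum_nonneg) auto
  show thesis
  proof (cases "s = 0")
    case True
    then have "w = 0"
      unfolding w_def s_def by (intro sum.neutral) (simp add: sum_nonneg_eq_0_iff)
    have "oct_e 7 = (\<Sum>i=p+1..7. (if i = 7 then 1 else 0) *\<^sub>R oct_e i)"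
      using assms by (simp add: if_distrib[of "\<lambda>r. r *\<^sub>R _"] cong: if_cong)
    moreover have "(\<Sum>i=p+1..7. (if i = 7 then 1 else 0 :: real)\<^sup>2) = 1"
      using assms by (simp add: if_distrib[of "\<lambda>r. r\<^sup>2"] cong: if_cong)
    ultimately have "oct_e 7 \<in> slice_sphere p"
      unfolding slice_sphere_def by (intro CollectI exI[of _ "\<lambda>i. if i = 7 then 1 else 0"]) auto
    then show thesis using that[of "oct_e 7" x 0] x a \<open>w = 0\<close> by simp
  next
    case False
    define \<omega> where "\<omega> = (\<Sum>i=p+1..7. ((a \<bullet> oct_e i) / sqrt s) *\<^sub>R oct_e i)"
    have "(\<Sum>i=p+1..7. ((a \<bullet> oct_e i) / sqrt s)\<^sup>2) = 1"
    proof -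
      have "(\<Sum>i=p+1..7. ((a \<bullet> oct_e i) / sqrt s)\<^sup>2) = (\<Sum>i=p+1..7. (a \<bullet> oct_e i)\<^sup>2) / s"
        using \<open>s \<ge> 0\<close> by (simp add: power_divide sum_divide_distrib)
      then show ?thesis unfolding s_def[symmetric] using False by simp
    qed
    then have "\<omega> \<in> slice_sphere p"
      unfolding slice_sphere_def \<omega>_def by (intro CollectI exI[of _ "\<lambda>i. (a \<bullet> oct_e i) / sqrt s"]) auto
    moreover have "w = sqrt s *\<^sub>R \<omega>"
      using False by (simp add: w_def \<omega>_def scaleR_sum_right)
    ultimately show thesis using that[of \<omega> x "sqrt s"] x a \<open>s \<ge> 0\<close> by simp
  qed
qed

text \<open>For \<open>\<omega>\<close> in the sphere, this is the orthogonal projection onto the slice space of \<open>\<omega>\<close>.\<close>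

definition slice_proj :: "nat \<Rightarrow> octonion \<Rightarrow> octonion \<Rightarrow> octonion" where
  "slice_proj p \<omega> x = (\<Sum>i\<le>p. (x \<bullet> oct_e i) *\<^sub>R oct_e i) + (x \<bullet> \<omega>) *\<^sub>R \<omega>"

lemma linear_slice_proj: "linear (slice_proj p \<omega>)"
  by (rule linearI)
    (simp_all add: slice_proj_def inner_add_left scaleR_add_left sum.distrib scaleR_add_right scaleR_sum_right)

lemma continuous_on_slice_proj: "continuous_on S (slice_proj p \<omega>)"
  using linear_slice_proj linear_continuous_on linear_conv_bounded_linear by blast

lemma slice_proj_in: "slice_proj p \<omega> x \<in> slice_space p \<omega>"
proof -
  have "(\<Sum>i\<le>p. (x \<bullet> oct_e i) *\<^sub>R oct_e i) \<in> paravectors p"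
    unfolding paravectors_def by (intro span_sum span_scale span_base) auto
  then show ?thesis unfolding slice_space_def slice_proj_def by blast
qed

lemma open_slice_tube: "open \<Omega> \<Longrightarrow> open {x. slice_proj p \<omega> x \<in> \<Omega>}"
  using open_vimage[OF _ continuous_on_slice_proj] by (simp add: vimage_def)

lemma slice_proj_paravectorI: "x \<bullet> \<omega> = 0 \<Longrightarrow> slice_proj p \<omega> x \<in> paravectors p"
  by (simp add: slice_proj_def paravectors_def) (intro span_sum span_scale span_base, auto)

text \<open>The partial derivative along the coordinate direction \<open>b\<close> of \<open>f\<close> composed with the projection.\<close>

definition lifted_partial :: "nat \<Rightarrow> octonion \<Rightarrow> (octonion \<Rightarrow> octonion) \<Rightarrow> octonion \<Rightarrow> octonion \<Rightarrow> octonion" where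
  "lifted_partial p \<omega> f b x =
     (if b \<in> oct_e ` {..p} then dir_deriv b f (slice_proj p \<omega> x)
      else (b \<bullet> \<omega>) *\<^sub>R dir_deriv \<omega> f (slice_proj p \<omega> x))"

context
  fixes p :: nat and \<omega> :: octonion
  assumes p: "p \<le> 6" and \<omega>: "\<omega> \<in> slice_sphere p"
begin

lemma slice_proj_oct_e: 
  assumes "j \<le> 7"
  shows "slice_proj p \<omega> (oct_e j) = (if j \<le> p then oct_e j else (oct_e j \<bullet> \<omega>) *\<^sub>R \<omega>)"
proof -
  have "(\<Sum>i\<le>p. (oct_e j \<bullet> oct_e i) *\<^sub>R oct_e i) = (\<Sum>i\<le>p. if j = i then oct_e i else 0)"
    using p assms by (intro sum.cong refl) (auto simp: oct_e_inner)
  moreover have "oct_e j \<bullet> \<omega> = 0" if "j \<le> p"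
    using slice_sphere_inner(1)[OF \<omega> that assms] by (simp add: inner_commute)
  ultimately show ?thesis by (auto simp: slice_proj_def)
qed

lemma slice_proj_omega: "slice_proj p \<omega> \<omega> = \<omega>"
  using slice_sphere_inner[OF \<omega>] p by (simp add: slice_proj_def)

lemma paravectors_orthogonal: "x \<in> paravectors p \<Longrightarrow> x \<bullet> \<omega> = 0"
  unfolding paravectors_def
proof (induction rule: span_induct)
  case base
  then show ?case by (auto simp: subspace_def inner_add_left)
next
  case (step x)
  then show ?case using slice_sphere_inner(1)[OF \<omega>] p by (auto simp: inner_commute)
qed

lemma slice_proj_paravector:
  assumes "x \<in> paravectors p"
  shows "slice_proj p \<omega> x = x"
proof -
  have "slice_proj p \<omega> x = id x"
    using assms unfolding paravectors_def
    by (rule linear_eq_on[OF linear_slice_proj linear_id]) (use slice_proj_oct_e p in auto)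
  then show ?thesis by simp
qed

lemma slice_proj_slice_space: "x \<in> slice_space p \<omega> \<Longrightarrow> slice_proj p \<omega> x = x"
  unfolding slice_space_def
  using linear_slice_proj[of p \<omega>] slice_proj_paravector slice_proj_omega
  by (auto simp: linear_add linear_scale)

text \<open>The preimage is the sum of the slice of the domain and the kernel of the projection, hence a
  continuous image of a product of connected sets.\<close>

lemma connected_slice_tube:
  assumes "connected (oct_slice p \<Omega> \<omega>)"
  shows "connected {x. slice_proj p \<omega> x \<in> \<Omega>}"
proof -
  define K where "K = {x. slice_proj p \<omega> x = 0}"
  have lin: "linear (slice_proj p \<omega>)" by (rule linear_slice_proj)
  have "subspace K" unfolding K_def using lin by (rule linear_subspace_kernel)
  then have "connected (oct_slice p \<Omega> \<omega> \<times> K)"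
    by (intro connected_Times assms convex_connected subspace_imp_convex)
  then have "connected ((\<lambda>(x, y). x + y) ` (oct_slice p \<Omega> \<omega> \<times> K))"
    by (rule connected_continuous_image[rotated]) (auto intro!: continuous_intros simp: split_beta)
  also have "(\<lambda>(x, y). x + y) ` (oct_slice p \<Omega> \<omega> \<times> K) = {x. slice_proj p \<omega> x \<in> \<Omega>}"
  proof (intro equalityI subsetI)
    fix z assume "z \<in> (\<lambda>(x, y). x + y) ` (oct_slice p \<Omega> \<omega> \<times> K)"
    then show "z \<in> {x. slice_proj p \<omega> x \<in> \<Omega>}"
      using lin slice_proj_slice_space by (auto simp: oct_slice_def K_def linear_add)
  next
    fix z assume z: "z \<in> {x. slice_proj p \<omega> x \<in> \<Omega>}"
    define x where "x = slice_proj p \<omega> z"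
    have "x \<in> oct_slice p \<Omega> \<omega>" using z slice_proj_in by (simp add: oct_slice_def x_def)
    moreover have "z - x \<in> K"
      using lin slice_proj_slice_space[OF slice_proj_in, of z] by (simp add: K_def linear_diff x_def)
    ultimately show "z \<in> (\<lambda>(x, y). x + y) ` (oct_slice p \<Omega> \<omega> \<times> K)"
      by (intro image_eqI[of _ _ "(x, z - x)"]) auto
  qed
  finally show ?thesis .
qed

lemma oct_e_mem_iff: "j \<le> 7 \<Longrightarrow> oct_e j \<in> oct_e ` {..p} \<longleftrightarrow> j \<le> p"
  using inj_on_oct_e p by (auto dest!: inj_onD[of oct_e "{..7}" j])

lemma has_partials_lift:
  assumes C1: "C1_on_slice p \<omega> \<Omega> f"
  shows "has_partials (\<lambda>x. f (slice_proj p \<omega> x)) (lifted_partial p \<omega> f) {x. slice_proj p \<omega> x \<in> \<Omega>}"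
  unfolding has_partials_def
proof (intro ballI conjI)
  let ?P = "slice_proj p \<omega>"
  have lin: "linear ?P" by (rule linear_slice_proj)
  have slice: "?P x \<in> oct_slice p \<Omega> \<omega>" if "x \<in> {x. ?P x \<in> \<Omega>}" for x
    using that slice_proj_in by (simp add: oct_slice_def)
  have der: "((\<lambda>t. f (?P x + t *\<^sub>R v)) has_vector_derivative dir_deriv v f (?P x)) (at 0)"
    if "v \<in> insert \<omega> (oct_e ` {..p})" "x \<in> {x. ?P x \<in> \<Omega>}" for v x
  proof -
    have "(\<lambda>t. f (?P x + t *\<^sub>R v)) differentiable (at 0)"
      using C1 that(1) slice[OF that(2)] unfolding C1_on_slice_def by blast
    then show ?thesis by (simp add: dir_deriv_def vector_derivative_works)
  qed
  have cont: "continuous_on {x. ?P x \<in> \<Omega>} (\<lambda>x. dir_deriv v f (?P x))"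
    if "v \<in> insert \<omega> (oct_e ` {..p})" for v
  proof (rule continuous_on_compose2[of _ "dir_deriv v f"])
    show "continuous_on (oct_slice p \<Omega> \<omega>) (dir_deriv v f)"
      using C1 that unfolding C1_on_slice_def by blast
  qed (use slice continuous_on_slice_proj in auto)
  fix b :: octonion assume "b \<in> Basis"
  then obtain j where j: "j \<le> 7" "b = oct_e j" unfolding Basis_octonion by auto
  show "continuous_on {x. ?P x \<in> \<Omega>} (lifted_partial p \<omega> f b)"
    unfolding lifted_partial_def[abs_def]
    using cont by (cases "b \<in> oct_e ` {..p}") (auto intro!: continuous_intros)
  fix x assume x: "x \<in> {x. ?P x \<in> \<Omega>}"
  show "((\<lambda>s. f (?P (x + s *\<^sub>R b))) has_vector_derivative lifted_partial p \<omega> f b x) (at 0)"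
  proof (cases "j \<le> p")
    case True
    have "?P (x + s *\<^sub>R b) = ?P x + s *\<^sub>R b" for s
      using True j lin slice_proj_oct_e by (simp add: linear_add linear_scale)
    then show ?thesis using der[of b x] x True j by (simp add: lifted_partial_def)
  next
    case False
    have eq: "?P (x + s *\<^sub>R b) = ?P x + (s * (b \<bullet> \<omega>)) *\<^sub>R \<omega>" for s
      using False j lin slice_proj_oct_e by (simp add: linear_add linear_scale)
    have "((\<lambda>s. s * (b \<bullet> \<omega>)) has_vector_derivative (b \<bullet> \<omega>)) (at 0)"
      by (auto intro!: derivative_eq_intros)
    from vector_diff_chain_at[OF this, of "\<lambda>t. f (?P x + t *\<^sub>R \<omega>)" "dir_deriv \<omega> f (?P x)"]
    have "((\<lambda>s. f (?P x + (s * (b \<bullet> \<omega>)) *\<^sub>R \<omega>)) has_vector_derivative (b \<bullet> \<omega>) *\<^sub>R dir_deriv \<omega> f (?P x)) (at 0)"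
      using der[of \<omega> x] x by (simp add: o_def)
    then show ?thesis unfolding eq using False j oct_e_mem_iff by (simp add: lifted_partial_def)
  qed
qed

text \<open>The directions \<open>e\<^sub>i\<close> with \<open>i > p\<close> contribute \<open>\<Sum>\<^sub>i \<langle>\<omega>, e\<^sub>i\<rangle> e\<^sub>i\<close> times the derivative along \<open>\<omega>\<close>, and this
  sum is \<open>\<omega>\<close>.\<close>

lemma dirac_lift:
  assumes "slice_dirac p \<omega> f (slice_proj p \<omega> x) = 0"
  shows "(\<Sum>i\<le>7. oct_e i \<otimes> lifted_partial p \<omega> f (oct_e i) x) = 0"
proof -
  let ?y = "slice_proj p \<omega> x"
  have split: "{..7} = {..p} \<union> {p+1..7}" using p by auto
  have "(\<Sum>i\<le>7. oct_e i \<otimes> lifted_partial p \<omega> f (oct_e i) x) =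
     (\<Sum>i\<le>p. oct_e i \<otimes> lifted_partial p \<omega> f (oct_e i) x) + (\<Sum>i=p+1..7. oct_e i \<otimes> lifted_partial p \<omega> f (oct_e i) x)"
    unfolding split by (intro sum.union_disjoint) auto
  also have "(\<Sum>i\<le>p. oct_e i \<otimes> lifted_partial p \<omega> f (oct_e i) x) = (\<Sum>i\<le>p. oct_e i \<otimes> dir_deriv (oct_e i) f ?y)"
    by (intro sum.cong) (auto simp: lifted_partial_def)
  also have "(\<Sum>i=p+1..7. oct_e i \<otimes> lifted_partial p \<omega> f (oct_e i) x) =
      (\<Sum>i=p+1..7. ((\<omega> \<bullet> oct_e i) *\<^sub>R oct_e i) \<otimes> dir_deriv \<omega> f ?y)"
  proof (intro sum.cong refl)
    fix i assume "i \<in> {p+1..7}"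
    then show "oct_e i \<otimes> lifted_partial p \<omega> f (oct_e i) x = ((\<omega> \<bullet> oct_e i) *\<^sub>R oct_e i) \<otimes> dir_deriv \<omega> f ?y"
      using oct_e_mem_iff[of i]
      by (simp add: lifted_partial_def oct_mult_scaleR_right oct_mult_scaleR_left inner_commute)
  qed
  also have "\<dots> = (\<Sum>i=p+1..7. (\<omega> \<bullet> oct_e i) *\<^sub>R oct_e i) \<otimes> dir_deriv \<omega> f ?y"
    by (simp add: oct_mult_sum_left)
  also have "(\<Sum>i=p+1..7. (\<omega> \<bullet> oct_e i) *\<^sub>R oct_e i) = (\<Sum>i\<le>7. (\<omega> \<bullet> oct_e i) *\<^sub>R oct_e i)"
    using slice_sphere_inner(1)[OF \<omega>] p by (intro sum.mono_neutral_left) auto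
  also have "\<dots> = \<omega>" by (rule octonion_representation)
  finally show ?thesis using assms by (simp add: slice_dirac_def)
qed

end

section \<open>The maximum modulus theorem\<close>

lemma has_partials_minus_const:
  "has_partials F F' U \<Longrightarrow> has_partials (\<lambda>x. F x - c) F' U"
  by (auto simp: has_partials_def has_vector_derivative_diff_const)

text \<open>At a point of the hyperplane \<open>F\<close> is \<open>o(s)\<close> along every coordinate line; replacing some of its values
  by zero keeps this, so the cut-off function has derivative zero there.\<close>

lemma has_partials_half_space_cutoff:
  fixes F :: "'a::euclidean_space \<Rightarrow> 'b::euclidean_space"
  assumes F: "has_partials F F' U"
    and zero: "\<And>x. x \<in> U \<Longrightarrow> x \<bullet> w = 0 \<Longrightarrow> F x = 0"
    and zero': "\<And>x b. x \<in> U \<Longrightarrow> x \<bullet> w = 0 \<Longrightarrow> b \<in> Basis \<Longrightarrow> F' b x = 0"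
  shows "has_partials (\<lambda>x. if x \<bullet> w \<le> 0 then 0 else F x) (\<lambda>b x. if x \<bullet> w \<le> 0 then 0 else F' b x) U"
  unfolding has_partials_def
proof (intro ballI conjI)
  fix b :: 'a assume b: "b \<in> Basis"
  have "continuous_on U (F' b)" using F b by (simp add: has_partials_def)
  then show "continuous_on U (\<lambda>x. if x \<bullet> w \<le> 0 then 0 else F' b x)"
    using zero'[OF _ _ b]
    by (intro continuous_on_cases_le continuous_intros) (auto intro: continuous_on_subset)
  fix x assume x: "x \<in> U"
  define G where "G s = (if (x + s *\<^sub>R b) \<bullet> w \<le> 0 then 0 else F (x + s *\<^sub>R b))" for s
  have der: "((\<lambda>s. F (x + s *\<^sub>R b)) has_vector_derivative F' b x) (at 0)"
    using F b x by (simp add: has_partials_def)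
  consider "x \<bullet> w > 0" | "x \<bullet> w < 0" | "x \<bullet> w = 0" by linarith
  then have "(G has_vector_derivative (if x \<bullet> w \<le> 0 then 0 else F' b x)) (at 0)"
  proof cases
    case 1
    have "open {s::real. (x + s *\<^sub>R b) \<bullet> w > 0}"
      by (intro open_Collect_less continuous_intros)
    with der have "(G has_vector_derivative F' b x) (at 0)"
      by (rule has_vector_derivative_transform_within_open) (use 1 in \<open>auto simp: G_def\<close>)
    then show ?thesis using 1 by simp
  next
    case 2
    have "open {s::real. (x + s *\<^sub>R b) \<bullet> w < 0}"
      by (intro open_Collect_less continuous_intros)
    with has_vector_derivative_const[of 0] have "(G has_vector_derivative 0) (at 0)"
      by (rule has_vector_derivative_transform_within_open) (use 2 in \<open>auto simp: G_def\<close>)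
    then show ?thesis using 2 by simp
  next
    case 3
    have *: "F x = 0" "F' b x = 0" using zero[OF x 3] zero'[OF x 3 b] .
    have lim: "((\<lambda>s. norm (F (x + s *\<^sub>R b)) / norm s) \<longlongrightarrow> 0) (at 0)"
      using der * by (simp add: has_vector_derivative_def has_derivative_at)
    have "((\<lambda>s. norm (G s) / norm s) \<longlongrightarrow> 0) (at 0)"
      by (rule Lim_null_comparison[OF _ lim]) (auto simp: G_def intro!: always_eventually divide_right_mono)
    then have "(G has_vector_derivative 0) (at 0)"
      using 3 by (simp add: has_vector_derivative_def has_derivative_at G_def[of 0])
    then show ?thesis using 3 by simp
  qed
  then show "((\<lambda>s. if (x + s *\<^sub>R b) \<bullet> w \<le> 0 then 0 else F (x + s *\<^sub>R b)) has_vector_derivative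
      (if x \<bullet> w \<le> 0 then 0 else F' b x)) (at 0)"
    by (simp only: G_def[abs_def])
qed

text \<open>The maximum principle makes the lifted function constant near \<open>a\<close>; unique continuation spreads this
  over the connected slice. The composite with the projection still has a relative maximum at \<open>a\<close>, because
  the projection is continuous and fixes \<open>a\<close>.\<close>

lemma constant_on_slice_of_max:
  assumes "p \<le> 6" "slice_domain p \<Omega>" "partial_slice_monogenic p \<Omega> f" and \<omega>: "\<omega> \<in> slice_sphere p"
    and a: "a \<in> oct_slice p \<Omega> \<omega>" and max: "relative_max_at \<Omega> (\<lambda>x. norm (f x)) a"
    and x: "x \<in> oct_slice p \<Omega> \<omega>"
  shows "f x = f a"
proof -
  let ?P = "slice_proj p \<omega>"
  define U where "U = {x. ?P x \<in> \<Omega>}"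
  define F where "F x = f (?P x)" for x
  have "open \<Omega>" using assms(2) by (simp add: slice_domain_def oct_domain_def)
  have U: "open U" "connected U"
    unfolding U_def using open_slice_tube[OF \<open>open \<Omega>\<close>] connected_slice_tube[OF assms(1) \<omega>] assms(2) \<omega>
    by (auto simp: slice_domain_def)
  have C1: "C1_on_slice p \<omega> \<Omega> f" using assms(3) \<omega> by (simp add: partial_slice_monogenic_def)
  have dirac: "slice_dirac p \<omega> f (?P x) = 0" if "x \<in> U" for x
    using assms(3) \<omega> that slice_proj_in by (simp add: partial_slice_monogenic_def oct_slice_def U_def)
  have mvF: "bump_mean_value F U"
    unfolding F_def[abs_def]
    by (rule octonion_monogenic_bump_mean_value[OF U(1) has_partials_lift[OF assms(1) \<omega> C1, folded U_def]
        dirac_lift[OF assms(1) \<omega> dirac]])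
  have fix_slice: "?P y = y" if "y \<in> oct_slice p \<Omega> \<omega>" for y
    using that slice_proj_slice_space[OF assms(1) \<omega>] by (simp add: oct_slice_def)
  have in_U: "y \<in> U" if "y \<in> oct_slice p \<Omega> \<omega>" for y
    using fix_slice[OF that] that by (simp add: U_def oct_slice_def)
  obtain d where d: "d > 0" "\<And>y. y \<in> \<Omega> \<Longrightarrow> dist y a < d \<Longrightarrow> norm (f y) \<le> norm (f a)"
    using max unfolding relative_max_at_def by blast
  have "open {x. ?P x \<in> \<Omega> \<inter> ball a d}"
    using \<open>open \<Omega>\<close> by (intro open_slice_tube open_Int) auto
  moreover have "a \<in> {x. ?P x \<in> \<Omega> \<inter> ball a d}"
    using fix_slice[OF a] a d(1) by (simp add: oct_slice_def)
  ultimately obtain t where t: "t > 0" "cball a t \<subseteq> {x. ?P x \<in> \<Omega> \<inter> ball a d}"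
    using open_contains_cball_eq by blast
  have sub: "cball a t \<subseteq> U" using t(2) by (auto simp: U_def)
  have const: "F y = F a" if "y \<in> ball a t" for y
  proof (rule bump_mean_value_norm_max_imp_const[OF U(1) mvF t(1) sub _ that])
    fix z assume "z \<in> ball a t"
    then have "?P z \<in> \<Omega> \<inter> ball a d" using t(2) ball_subset_cball by blast
    then show "norm (F z) \<le> norm (F a)"
      using d(2)[of "?P z"] fix_slice[OF a] by (simp add: F_def dist_commute)
  qed
  have "F x - F a = 0"
  proof (rule bump_mean_value_unique_continuation[OF U bump_mean_value_diff[OF U(1) mvF bump_mean_value_const]])
    show "ball a t \<subseteq> U" using sub ball_subset_cball by blast
    show "ball a t \<noteq> {}" using t(1) by simp
  qed (use const in_U[OF x] in auto)
  then show ?thesis using fix_slice a x by (simp add: F_def)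
qed

text \<open>Uniqueness in the Cauchy problem with data on the hyperplane of paravectors. On that hyperplane
  the tangential derivatives of \<open>f - c\<close> vanish; the equation reduces to \<open>\<omega> \<partial>\<^sub>r f = 0\<close>, so \<open>\<partial>\<^sub>r f = 0\<close> as
  well. The extension by zero across the hyperplane is thus again a solution, and it vanishes on an
  open set.\<close>

lemma constant_on_half_slice:
  assumes "p \<le> 6" "slice_domain p \<Omega>" "partial_slice_monogenic p \<Omega> f" and \<omega>: "\<omega> \<in> slice_sphere p"
    and const: "\<And>y. y \<in> \<Omega> \<inter> paravectors p \<Longrightarrow> f y = c"
    and x: "x \<in> oct_slice p \<Omega> \<omega>" "x \<bullet> \<omega> > 0"
  shows "f x = c"
proof -
  let ?P = "slice_proj p \<omega>"
  define U where "U = {x. ?P x \<in> \<Omega>}"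
  define F where "F x = f (?P x) - c" for x
  define F' where "F' = lifted_partial p \<omega> f"
  have "open \<Omega>" using assms(2) by (simp add: slice_domain_def oct_domain_def)
  have U: "open U" "connected U"
    unfolding U_def using open_slice_tube[OF \<open>open \<Omega>\<close>] connected_slice_tube[OF assms(1) \<omega>] assms(2) \<omega>
    by (auto simp: slice_domain_def)
  have C1: "C1_on_slice p \<omega> \<Omega> f" using assms(3) \<omega> by (simp add: partial_slice_monogenic_def)
  have dirac: "slice_dirac p \<omega> f (?P x) = 0" if "x \<in> U" for x
    using assms(3) \<omega> that slice_proj_in by (simp add: partial_slice_monogenic_def oct_slice_def U_def)
  have F: "has_partials F F' U"
    unfolding F_def[abs_def] F'_def U_def
    by (rule has_partials_minus_const[OF has_partials_lift[OF assms(1) \<omega> C1]])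
  have hyper: "F y = 0" if "y \<in> U" "y \<bullet> \<omega> = 0" for y
    using that const[of "?P y"] slice_proj_paravectorI by (simp add: F_def U_def)
  have hyper': "F' b y = 0" if y: "y \<in> U" "y \<bullet> \<omega> = 0" and b: "b \<in> Basis" for y b
  proof -
    have tangential: "F' (oct_e i) y = 0" if i: "i \<le> p" for i
    proof -
      have e: "oct_e i \<bullet> \<omega> = 0" using slice_sphere_inner(1)[OF \<omega> i] i assms(1) by (simp add: inner_commute)
      have "oct_e i \<in> Basis" using i assms(1) by (simp add: Basis_octonion)
      then have 1: "((\<lambda>s. F (y + s *\<^sub>R oct_e i)) has_vector_derivative F' (oct_e i) y) (at 0)"
        using F y(1) by (simp add: has_partials_def)
      have "open ((\<lambda>s::real. y + s *\<^sub>R oct_e i) -` U)"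
        using U(1) by (intro open_vimage continuous_intros)
      with has_vector_derivative_const[of 0]
      have "((\<lambda>s. F (y + s *\<^sub>R oct_e i)) has_vector_derivative 0) (at 0)"
        by (rule has_vector_derivative_transform_within_open)
           (use y e hyper in \<open>auto simp: inner_add_left\<close>)
      with 1 show ?thesis by (rule vector_derivative_unique_at)
    qed
    have "dir_deriv (oct_e i) f (?P y) = 0" if "i \<le> p" for i
      using tangential[OF that] that by (simp add: F'_def lifted_partial_def)
    then have "\<omega> \<otimes> dir_deriv \<omega> f (?P y) = 0"
      using dirac[OF y(1)] by (simp add: slice_dirac_def oct_mult_0_right)
    moreover have "\<omega> \<noteq> 0" using slice_sphere_inner(2)[OF \<omega>] by auto
    ultimately have "dir_deriv \<omega> f (?P y) = 0" by (rule oct_mult_left_cancel_0)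
    then show ?thesis
      using tangential by (auto simp: F'_def lifted_partial_def)
  qed
  define G where "G x = (if x \<bullet> \<omega> \<le> 0 then 0 else F x)" for x
  have mvG: "bump_mean_value G U"
    unfolding G_def[abs_def]
  proof (rule octonion_monogenic_bump_mean_value[OF U(1) has_partials_half_space_cutoff[OF F hyper hyper']])
    show "(\<Sum>i\<le>7. oct_e i \<otimes> (if y \<bullet> \<omega> \<le> 0 then 0 else F' (oct_e i) y)) = 0" if "y \<in> U" for y
      using dirac_lift[OF assms(1) \<omega> dirac[OF that]]
      by (cases "y \<bullet> \<omega> \<le> 0") (simp_all add: F'_def oct_mult_0_right)
  qed
  obtain x0 where x0: "x0 \<in> \<Omega>" "x0 \<in> paravectors p"
    using assms(2) by (auto simp: slice_domain_def)
  have "x0 \<in> U" using x0 slice_proj_paravector[OF assms(1) \<omega>] by (simp add: U_def)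
  then obtain e where e: "e > 0" "cball x0 e \<subseteq> U"
    using open_contains_cball_eq[OF U(1)] by blast
  have "norm \<omega> = 1" using slice_sphere_inner(2)[OF \<omega>] by (simp add: norm_eq_1)
  then have "x0 - e *\<^sub>R \<omega> \<in> U"
    using e by (auto simp: dist_norm)
  moreover have "(x0 - e *\<^sub>R \<omega>) \<bullet> \<omega> < 0"
    using e(1) slice_sphere_inner(2)[OF \<omega>] paravectors_orthogonal[OF assms(1) \<omega> x0(2)]
    by (simp add: inner_diff_left)
  ultimately have ne: "U \<inter> {x. x \<bullet> \<omega> < 0} \<noteq> {}" by blast
  have fix_x: "?P x = x"
    using x slice_proj_slice_space[OF assms(1) \<omega>] by (simp add: oct_slice_def)
  have "G x = 0"
  proof (rule bump_mean_value_unique_continuation[OF U mvG _ _ ne])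
    show "open (U \<inter> {x. x \<bullet> \<omega> < 0})"
      by (intro open_Int U(1) open_Collect_less continuous_intros)
    show "x \<in> U" using x fix_x by (simp add: U_def oct_slice_def)
  qed (auto simp: G_def)
  then show ?thesis using x(2) fix_x by (simp add: G_def F_def)
qed

theorem theorem4p10:
  fixes p :: nat and \<Omega> :: "octonion set" and f :: "octonion \<Rightarrow> octonion"
  assumes "p \<le> 6"
    and "slice_domain p \<Omega>"
    and "partial_slice_monogenic p \<Omega> f"
    and "\<exists>a \<in> \<Omega>. relative_max_at \<Omega> (\<lambda>x. norm (f x)) a"
  shows "f constant_on \<Omega>"
proof -
  obtain a where a: "a \<in> \<Omega>" "relative_max_at \<Omega> (\<lambda>x. norm (f x)) a"
    using assms(4) by blast
  obtain y0 r0 \<omega>0 where \<omega>0: "\<omega>0 \<in> slice_sphere p" and "y0 \<in> paravectors p" "a = y0 + r0 *\<^sub>R \<omega>0"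
    using slice_sphere_decomposition[OF assms(1), of a] by blast
  then have "a \<in> oct_slice p \<Omega> \<omega>0"
    using a(1) by (auto simp: oct_slice_def slice_space_def)
  note slice0 = constant_on_slice_of_max[OF assms(1-3) \<omega>0 this a(2)]
  have on_paravectors: "f y = f a" if "y \<in> \<Omega> \<inter> paravectors p" for y
  proof (rule slice0)
    have "y = y + 0 *\<^sub>R \<omega>0" by simp
    then show "y \<in> oct_slice p \<Omega> \<omega>0" using that unfolding oct_slice_def slice_space_def by blast
  qed
  have "f x = f a" if x: "x \<in> \<Omega>" for x
  proof -
    obtain y r \<omega> where \<omega>: "\<omega> \<in> slice_sphere p" and y: "y \<in> paravectors p" and r: "r \<ge> 0"
      and xy: "x = y + r *\<^sub>R \<omega>"
      using slice_sphere_decomposition[OF assms(1), of x] by blast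
    show ?thesis
    proof (cases "r = 0")
      case True
      then show ?thesis using on_paravectors x y xy by simp
    next
      case False
      have "x \<in> oct_slice p \<Omega> \<omega>"
        using x xy y by (auto simp: oct_slice_def slice_space_def)
      moreover have "x \<bullet> \<omega> > 0"
        using False r xy slice_sphere_inner(2)[OF \<omega>] paravectors_orthogonal[OF assms(1) \<omega> y]
        by (simp add: inner_add_left)
      ultimately show ?thesis
        using constant_on_half_slice[OF assms(1-3) \<omega> on_paravectors] by blast
    qed
  qed
  then show ?thesis by (auto simp: constant_on_def)
qed

end
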